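(* Let $k\ge 1$ be an integer, let $\ell\ge 1$ be an odd integer, and let $d\ge 0$ be an integer. Then for every polynomial $p\colon\mathbb{F}_2^{k\ell}\to\mathbb{F}_2$ of total degree at most $d$, \[ \operatorname{corr}\bigl(\mathsf{Maj}_{\ell}^{\oplus k},\,p\bigr)\le\left(\frac{2d}{\sqrt{\ell}}\right)^k . \]
   Context: For functions $f,g\colon\mathbb{F}_2^n\to\mathbb{F}_2$, the correlation is $\operatorname{corr}(f,g)=\bigl|\mathbb{E}_x[(-1)^{f(x)+g(x)}]\bigr|$, where $x$ is uniform over $\mathbb{F}_2^n$. For odd $\ell$, the Majority function $\mathrm{Maj}\colon\{0,1\}^\ell\to\{0,1\}$ is given by $\mathrm{Maj}(z)=1$ if and only if the Hamming weight $|z|$ is at least $(\ell+1)/2$. An input $x\in\mathbb{F}_2^{k\ell}$ is partitioned into $k$ consecutive disjoint blocks $x^{(1)},\ldots,x^{(k)}\in\{0,1\}^\ell$, and \[ \mathsf{Maj}_\ell^{\oplus k}(x)=\bigoplus_{i=1}^k \mathrm{Maj}(x^{(i)}), \] where $\oplus$ is addition in $\mathbb{F}_2$. *)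

theory Defs
  imports "HOL-Probability.Probability" "HOL-Library.Z2" "HOL-Library.Poly_Mapping"
begin

text \<open>
  The field \<open>\<F>\<^sub>2\<close> is the library type \<^typ>\<open>bit\<close>. Since the dimension varies inside the
  statement, a point of \<open>\<F>\<^sub>2\<^sup>n\<close> is a function on \<^typ>\<open>nat\<close> that is extensional
  on the index set \<open>{0, \<dots>, n - 1}\<close>.
\<close>

definition cube :: "nat \<Rightarrow> (nat \<Rightarrow> bit) set" where
  "cube n = PiE {..<n} (\<lambda>_. UNIV)"

definition bit_sign :: "bit \<Rightarrow> real" where
  "bit_sign b = (- 1) ^ (of_bool (b = 1) :: nat)"

definition corr :: "nat \<Rightarrow> ((nat \<Rightarrow> bit) \<Rightarrow> bit) \<Rightarrow> ((nat \<Rightarrow> bit) \<Rightarrow> bit) \<Rightarrow> real" where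
  "corr n f g = \<bar>measure_pmf.expectation (pmf_of_set (cube n)) (\<lambda>x. bit_sign (f x + g x))\<bar>"

definition weight :: "nat \<Rightarrow> (nat \<Rightarrow> bit) \<Rightarrow> nat" where
  "weight l z = card {j. j < l \<and> z j = 1}"

text \<open>Only meant for odd \<open>l\<close>, so that the division is exact.\<close>

definition maj :: "nat \<Rightarrow> (nat \<Rightarrow> bit) \<Rightarrow> bit" where
  "maj l z = (if weight l z \<ge> (l + 1) div 2 then 1 else 0)"

text \<open>Blocks are numbered from \<open>0\<close>.\<close>

definition block :: "nat \<Rightarrow> nat \<Rightarrow> (nat \<Rightarrow> bit) \<Rightarrow> (nat \<Rightarrow> bit)" where
  "block l i x = (\<lambda>j\<in>{..<l}. x (i * l + j))"

definition xor_maj :: "nat \<Rightarrow> nat \<Rightarrow> (nat \<Rightarrow> bit) \<Rightarrow> bit" where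
  "xor_maj k l x = (\<Sum>i<k. maj l (block l i x))"

text \<open>
  Multivariate polynomials over \<open>'a\<close> with indeterminates \<open>X\<^sub>0, X\<^sub>1, \<dots>\<close>:
  a monomial is a finitely supported map from variable indices to exponents, a polynomial a
  finitely supported map from monomials to coefficients. The polynomials in
  \<open>X\<^sub>0, \<dots>, X\<^sub>n\<^sub>-\<^sub>1\<close> are those with \<open>poly_vars p \<subseteq> {..<n}\<close>.
\<close>

type_synonym 'a mpoly = "(nat \<Rightarrow>\<^sub>0 nat) \<Rightarrow>\<^sub>0 'a"

definition poly_vars :: "'a::zero mpoly \<Rightarrow> nat set" where
  "poly_vars p = (\<Union>m\<in>Poly_Mapping.keys p. Poly_Mapping.keys m)"

definition monom_degree :: "(nat \<Rightarrow>\<^sub>0 nat) \<Rightarrow> nat" where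
  "monom_degree m = (\<Sum>i\<in>Poly_Mapping.keys m. Poly_Mapping.lookup m i)"

text \<open>The zero polynomial is given degree \<open>0\<close>, so it satisfies every bound on the degree.\<close>

definition total_degree :: "'a::zero mpoly \<Rightarrow> nat" where
  "total_degree p = Max (insert 0 (monom_degree ` Poly_Mapping.keys p))"

definition poly_eval :: "'a::comm_semiring_1 mpoly \<Rightarrow> (nat \<Rightarrow> 'a) \<Rightarrow> 'a" where
  "poly_eval p x =
     (\<Sum>m\<in>Poly_Mapping.keys p. Poly_Mapping.lookup p m *
        (\<Prod>i\<in>Poly_Mapping.keys m. x i ^ Poly_Mapping.lookup m i))"

end

theory Submission
  imports Defs "HOL-Library.Function_Algebras"
begin

text \<open>
  Let \<open>l = 2m + 1\<close>, \<open>f = Maj\<close>, and let \<open>V\<close> be the functions of degree at most \<open>m\<close> on one block.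
  Since \<open>V\<close> restricts isomorphically to \<open>{f = 0}\<close> and to \<open>{f = 1}\<close>, every function is uniquely
  \<open>v + f w\<close> with \<open>v, w \<in> V\<close>. A basis \<open>X\<close> of \<open>V\<close> adapted to both filtrations \<open>deg A\<close> and \<open>deg (f A)\<close>
  (Bruhat decomposition for two flags) makes the elements \<open>A, f A\<close> a basis of all functions that is
  adapted to the degree. As \<open>deg A \<le> m < deg (f A)\<close>, at most \<open>d * (l choose m)\<close> of the \<open>A \<in> X\<close> are bad,
  i.e. satisfy \<open>deg (f A) \<le> deg A + d\<close>.

  For \<open>k\<close> blocks take products of these basis elements, and let \<open>W\<close> consist of the products having some
  good block such that the first good block carries \<open>A\<close> and not \<open>f A\<close>. If \<open>deg p \<le> d\<close> and
  \<open>e = f\<^sub>1 + \<dots> + f\<^sub>k + p\<close>, then \<open>e u \<noteq> 0\<close> for every nonzero \<open>u\<close> in the span of \<open>W\<close>: multiplying by \<open>f\<close> in the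
  first good block raises the degree by more than \<open>d\<close>, so \<open>p\<close> cannot cancel the highest resulting
  product. Hence \<open>e = 1\<close>, and likewise \<open>e = 0\<close>, has at least \<open>card W\<close> solutions, and all but
  \<open>(2 * bad)\<^sup>k\<close> of the \<open>2\<^sup>k\<^sup>l\<close> products are counted by \<open>2 * card W\<close>.
\<close>

section \<open>Bases adapted to two filtrations\<close>

text \<open>Among the subsets of \<open>V\<close> with the spanning property (\<open>V\<close>
  itself is one) take one of least cardinality. Minimality keeps each \<open>y\<close> out of the
  span of the other elements at or below its own pair of levels. A linear relation would violate
  this for a term of highest \<open>P\<close>-level and, among those, of highest
  \<open>Q\<close>-level.\<close>

lemma (in vector_space) bifiltered_basis:
  fixes P Q :: "nat \<Rightarrow> 'b set"
  assumes "finite V" and "subspace V"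
    and subP: "\<And>i. subspace (P i)" and "mono P" and VP: "\<And>v. v \<in> V \<Longrightarrow> \<exists>i. v \<in> P i"
    and subQ: "\<And>j. subspace (Q j)" and "mono Q" and VQ: "\<And>v. v \<in> V \<Longrightarrow> \<exists>j. v \<in> Q j"
  shows "\<exists>X \<subseteq> V. independent X \<and>
    (\<forall>v\<in>V. \<forall>i j. v \<in> P i \<longrightarrow> v \<in> Q j \<longrightarrow> v \<in> span (X \<inter> P i \<inter> Q j))"
proof -
  define adapted where "adapted X \<longleftrightarrow> X \<subseteq> V \<and>
    (\<forall>v\<in>V. \<forall>i j. v \<in> P i \<longrightarrow> v \<in> Q j \<longrightarrow> v \<in> span (X \<inter> P i \<inter> Q j))" for X
  have "adapted V"
    by (auto simp: adapted_def intro: span_base)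
  then obtain X where X: "adapted X" and least: "\<And>X'. adapted X' \<Longrightarrow> card X \<le> card X'"
    using arg_min_nat_lemma[of adapted V card] by blast
  have XV: "X \<subseteq> V" and spanX: "\<And>v i j. v \<in> V \<Longrightarrow> v \<in> P i \<Longrightarrow> v \<in> Q j \<Longrightarrow> v \<in> span (X \<inter> P i \<inter> Q j)"
    using X by (auto simp: adapted_def)
  have finX: "finite X"
    using XV \<open>finite V\<close> by (rule finite_subset)
  define a where "a v = (LEAST i. v \<in> P i)" for v
  define b where "b v = (LEAST j. v \<in> Q j)" for v
  have aP: "v \<in> P i \<longleftrightarrow> a v \<le> i" if "v \<in> V" for v i
    using VP[OF that] \<open>mono P\<close> unfolding a_def
    by (metis (no_types, lifting) LeastI_ex Least_le monoD subsetD)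
  have bQ: "v \<in> Q j \<longleftrightarrow> b v \<le> j" if "v \<in> V" for v j
    using VQ[OF that] \<open>mono Q\<close> unfolding b_def
    by (metis (no_types, lifting) LeastI_ex Least_le monoD subsetD)
  \<comment> \<open>An element redundant at its own pair of levels is redundant at every pair where
    it occurs, so deleting it would leave a smaller adapted set.\<close>
  have irredundant: "y \<notin> span (X \<inter> P (a y) \<inter> Q (b y) - {y})" if "y \<in> X" for y
  proof
    assume y: "y \<in> span (X \<inter> P (a y) \<inter> Q (b y) - {y})"
    have "v \<in> span ((X - {y}) \<inter> P i \<inter> Q j)" if v: "v \<in> V" "v \<in> P i" "v \<in> Q j" for v i j
    proof (cases "y \<in> P i \<inter> Q j")
      case True
      then have le: "a y \<le> i" "b y \<le> j"
        using aP bQ XV \<open>y \<in> X\<close> by auto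
      have "X \<inter> P (a y) \<inter> Q (b y) - {y} \<subseteq> (X - {y}) \<inter> P i \<inter> Q j"
        using le monoD[OF \<open>mono P\<close> le(1)] monoD[OF \<open>mono Q\<close> le(2)] by auto
      then have "y \<in> span ((X - {y}) \<inter> P i \<inter> Q j)"
        using y span_mono by blast
      moreover have "v \<in> span (insert y ((X - {y}) \<inter> P i \<inter> Q j))"
        using spanX[OF v] by (rule subsetD[OF span_mono, rotated]) auto
      ultimately show ?thesis
        using span_redundant by blast
    next
      case False
      then have "X \<inter> P i \<inter> Q j = (X - {y}) \<inter> P i \<inter> Q j"
        by auto
      then show ?thesis
        using spanX[OF v] by simp
    qed
    then have "adapted (X - {y})"
      using XV by (auto simp: adapted_def)
    from least[OF this] show False
      using \<open>y \<in> X\<close> finX by (metis card_Diff1_less leD)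
  qed
  have "independent X"
  proof
    assume "dependent X"
    then obtain T u where T: "finite T" "T \<subseteq> X" and rel: "(\<Sum>v\<in>T. scale (u v) v) = 0"
      and nz: "\<exists>v\<in>T. u v \<noteq> 0"
      unfolding dependent_explicit by blast
    define Y where "Y = {v \<in> T. u v \<noteq> 0}"
    have Y: "finite Y" "Y \<noteq> {}" "Y \<subseteq> X"
      using T nz by (auto simp: Y_def)
    have relY: "(\<Sum>v\<in>Y. scale (u v) v) = 0"
      unfolding Y_def using rel T by (subst sum.mono_neutral_left[of T]) auto
    define i where "i = Max (a ` Y)"
    have ai: "a v \<le> i" if "v \<in> Y" for v
      using Y that by (simp add: i_def)
    \<comment> \<open>The terms of top \<open>P\<close>-level; \<open>y\<close> below is one of them
      with top \<open>Q\<close>-level \<open>j\<close>.\<close>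
    define Z where "Z = {v \<in> Y. a v = i}"
    have "i \<in> a ` Y"
      unfolding i_def using Y by (intro Max_in) auto
    then have Z: "finite Z" "Z \<noteq> {}" "Z \<subseteq> Y"
      using Y by (auto simp: Z_def)
    define j where "j = Max (b ` Z)"
    have bj: "b v \<le> j" if "v \<in> Z" for v
      using Z that by (simp add: j_def)
    have "j \<in> b ` Z"
      unfolding j_def using Z by (intro Max_in) auto
    then obtain y where y: "y \<in> Z" "b y = j"
      by auto
    have yX: "y \<in> X" "y \<in> Y" "a y = i" "u y \<noteq> 0"
      using y Y Z by (auto simp: Z_def Y_def)
    let ?R = "X \<inter> P i \<inter> Q j - {y}"
    define w where "w = (\<Sum>v\<in>Z. scale (u v) v)"
    have w_eq: "w = - (\<Sum>v\<in>Y-Z. scale (u v) v)"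
      unfolding w_def using relY sum.subset_diff[OF Z(3) Y(1), of "\<lambda>v. scale (u v) v"]
      by (simp add: eq_neg_iff_add_eq_0 add.commute)
    have wV: "w \<in> V"
      unfolding w_def using \<open>subspace V\<close> Z Y XV
      by (intro subspace_sum) (auto intro!: subspace_scale)
    have wQ: "w \<in> Q j"
      unfolding w_def using Z Y XV bj bQ subQ
      by (intro subspace_sum[OF subQ] subspace_scale[OF subQ]) (auto simp: subset_iff)
    \<comment> \<open>As a sum over \<open>Z\<close>, \<open>w\<close> lies in \<open>Q j\<close>;
      as minus the remaining terms it lies in \<open>P (i - 1)\<close>. Hence it is spanned by
      elements of \<open>P\<close>-level below \<open>i\<close>, so without \<open>y\<close>. If no
      terms remain, then \<open>w = 0\<close>; this case includes \<open>i = 0\<close>.\<close>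
    have "w \<in> span ?R"
    proof (cases "Y - Z = {}")
      case True
      then show ?thesis
        unfolding w_eq True by (simp add: span_zero)
    next
      case False
      then have lt: "a v \<le> i - 1" "0 < i" if "v \<in> Y - Z" for v
        using ai[of v] that by (auto simp: Z_def)
      have "i > 0"
        using False lt by blast
      have "w \<in> P (i - 1)"
        unfolding w_eq using Y XV lt(1) aP subP
        by (intro subspace_neg[OF subP] subspace_sum[OF subP] subspace_scale[OF subP]) (auto simp: subset_iff)
      from spanX[OF wV this wQ] have "w \<in> span (X \<inter> P (i - 1) \<inter> Q j)" .
      moreover have "X \<inter> P (i - 1) \<inter> Q j \<subseteq> ?R"
        using aP[of y] yX XV \<open>i > 0\<close> monoD[OF \<open>mono P\<close>, of "i - 1" i] by auto
      ultimately show ?thesis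
        using span_mono by blast
    qed
    moreover have "(\<Sum>v\<in>Z-{y}. scale (u v) v) \<in> span ?R"
    proof (intro span_sum span_scale span_base)
      fix v assume v: "v \<in> Z - {y}"
      then have "v \<in> X"
        using Z Y by auto
      then show "v \<in> ?R"
        using v aP[of v] bQ[of v] bj[of v] XV by (auto simp: Z_def)
    qed
    ultimately have "w - (\<Sum>v\<in>Z-{y}. scale (u v) v) \<in> span ?R"
      by (rule span_diff)
    also have "w - (\<Sum>v\<in>Z-{y}. scale (u v) v) = scale (u y) y"
      unfolding w_def using Z y by (simp add: sum.remove)
    finally have "scale (u y) y \<in> span ?R" .
    from span_scale[OF this, of "inverse (u y)"] have "y \<in> span ?R"
      using yX by simp
    then show False
      using irredundant[OF yX(1)] y yX by simp
  qed
  with XV spanX show ?thesis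
    by (intro exI[of _ X]) simp
qed

section \<open>Functions of bounded degree on the cube\<close>

text \<open>By default the simplifier rewrites \<open>+\<close> and \<open>*\<close> on \<^typ>\<open>bit\<close> to bit operations.\<close>

declare add_bit_eq_xor [simp del] mult_bit_eq_and [simp del]

section \<open>The F_2-vector space of functions\<close>

definition bit_scale :: "bit \<Rightarrow> ('a \<Rightarrow> bit) \<Rightarrow> 'a \<Rightarrow> bit" where
  "bit_scale c g = (\<lambda>x. c * g x)"

interpretation bf: vector_space "bit_scale :: bit \<Rightarrow> ('a \<Rightarrow> bit) \<Rightarrow> 'a \<Rightarrow> bit"
  by standard (auto simp: bit_scale_def fun_eq_iff algebra_simps)

lemma bit_scale_0 [simp]: "bit_scale 0 g = 0"
  by (auto simp: bit_scale_def fun_eq_iff)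

lemma bit_scale_apply [simp]: "bit_scale c g x = c * g x"
  by (simp add: bit_scale_def)

lemma bit_add_self [simp]: "(a :: bit) + a = 0"
  by (cases a) auto

lemma bit_add_self_left [simp]: "(a :: bit) + (a + b) = b"
  by (cases a; cases b) auto

lemma bit_fun_add_self [simp]: "(g :: 'a \<Rightarrow> bit) + g = 0"
  by (simp add: fun_eq_iff)

text \<open>The only scalars are 0 and 1, so closure under scaling is automatic.\<close>

lemma bit_subspaceI:
  assumes "0 \<in> V" "\<And>g h. g \<in> V \<Longrightarrow> h \<in> V \<Longrightarrow> g + h \<in> V"
  shows "bf.subspace V"
proof (rule bf.subspaceI)
  show "bit_scale c g \<in> V" if "g \<in> V" for c g
    using that assms(1) by (cases c) auto
qed (use assms in auto)

lemma sum_fun_apply: "(\<Sum>a\<in>A. F a) x = (\<Sum>a\<in>A. F a x)"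
  by (induction A rule: infinite_finite_induct) auto

section \<open>The cube and the filtration of its functions by degree\<close>

lemma UNIV_bit: "UNIV = {0, 1 :: bit}"
  using bit_not_one_iff by auto

lemma finite_cube: "finite (cube n)"
  unfolding cube_def UNIV_bit by (rule finite_PiE) auto

lemma card_cube: "card (cube n) = 2 ^ n"
  unfolding cube_def UNIV_bit by (subst card_PiE) (auto simp: numeral_2_eq_2)

text \<open>The indicator factor represents a function on the cube by its extension by zero, so that
  agreement on the cube becomes equality of functions.\<close>

definition cube_monom :: "nat \<Rightarrow> nat set \<Rightarrow> (nat \<Rightarrow> bit) \<Rightarrow> bit" where
  "cube_monom n S = (\<lambda>x. of_bool (x \<in> cube n) * (\<Prod>i\<in>S. x i))"

definition deg_le :: "nat \<Rightarrow> nat \<Rightarrow> ((nat \<Rightarrow> bit) \<Rightarrow> bit) set" where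
  "deg_le n r = bf.span (cube_monom n ` {S. S \<subseteq> {..<n} \<and> card S \<le> r})"

lemma subspace_deg_le: "bf.subspace (deg_le n r)"
  by (simp add: deg_le_def)

lemmas deg_le_add = bf.subspace_add[OF subspace_deg_le]
  and deg_le_0 = bf.subspace_0[OF subspace_deg_le]
  and deg_le_sum = bf.subspace_sum[OF subspace_deg_le]

lemma cube_monom_in_deg_le: "S \<subseteq> {..<n} \<Longrightarrow> card S \<le> r \<Longrightarrow> cube_monom n S \<in> deg_le n r"
  unfolding deg_le_def by (rule bf.span_base) auto

lemma deg_le_induct [consumes 1, case_names subspace monom]:
  assumes "g \<in> deg_le n r" and "bf.subspace {g. R g}"
    and "\<And>S. S \<subseteq> {..<n} \<Longrightarrow> card S \<le> r \<Longrightarrow> R (cube_monom n S)"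
  shows "R g"
  by (rule bf.span_induct[OF assms(1)[unfolded deg_le_def] assms(2)]) (use assms(3) in auto)

lemma deg_le_mono: "r \<le> s \<Longrightarrow> deg_le n r \<subseteq> deg_le n s"
  unfolding deg_le_def by (intro bf.span_mono) auto

lemma mono_deg_le: "mono (deg_le n)"
  by (simp add: deg_le_mono monoI)

lemma deg_le_outside:
  assumes "g \<in> deg_le n r" "x \<notin> cube n"
  shows "g x = 0"
  using assms(1)
proof (induction rule: deg_le_induct)
  case subspace
  show ?case
    by (rule bit_subspaceI) auto
qed (use assms(2) in \<open>simp add: cube_monom_def\<close>)

text \<open>Over F_2 squares of variables disappear, so index sets unite instead of exponents
  adding.\<close>

lemma cube_monom_mult:
  assumes "finite S" "finite T"
  shows "cube_monom n S * cube_monom n T = cube_monom n (S \<union> T)"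
proof -
  have *: "(\<Prod>i\<in>A. x i) = of_bool (\<forall>i\<in>A. x i = 1)" if "finite A" for A and x :: "nat \<Rightarrow> bit"
    using that by (induction A) auto
  show ?thesis
    using assms by (auto simp: cube_monom_def fun_eq_iff *)
qed

lemma deg_le_mult:
  assumes g: "g \<in> deg_le n r" and h: "h \<in> deg_le n s"
  shows "g * h \<in> deg_le n (r + s)"
proof -
  have base: "cube_monom n S * cube_monom n T \<in> deg_le n (r + s)"
    if "S \<subseteq> {..<n} \<and> card S \<le> r" "T \<subseteq> {..<n} \<and> card T \<le> s" for S T
  proof -
    have fin: "finite S" "finite T"
      using that finite_subset by auto
    have "card (S \<union> T) \<le> r + s"
      using card_Un_le[of S T] that by linarith
    then show ?thesis
      unfolding cube_monom_mult[OF fin] using that by (intro cube_monom_in_deg_le) auto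
  qed
  have "cube_monom n S * h \<in> deg_le n (r + s)" if S: "S \<subseteq> {..<n} \<and> card S \<le> r" for S
  proof -
    have "bf.subspace {h. cube_monom n S * h \<in> deg_le n (r + s)}"
      by (rule bit_subspaceI) (auto simp: distrib_left deg_le_0 deg_le_add)
    with h show ?thesis
      by (rule deg_le_induct) (use base[OF S] in auto)
  qed
  moreover have "bf.subspace {g. g * h \<in> deg_le n (r + s)}"
    by (rule bit_subspaceI) (auto simp: distrib_right deg_le_0 deg_le_add)
  ultimately show ?thesis
    using deg_le_induct[OF g] by blast
qed

lemma deg_le_prod:
  assumes "finite J" "\<And>j. j \<in> J \<Longrightarrow> (\<lambda>x. of_bool (x \<in> cube n) * G j x) \<in> deg_le n (r j)"
  shows "(\<lambda>x. of_bool (x \<in> cube n) * (\<Prod>j\<in>J. G j x)) \<in> deg_le n (\<Sum>j\<in>J. r j)"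
  using assms
proof (induction J)
  case empty
  have "(\<lambda>x. of_bool (x \<in> cube n)) = cube_monom n {}"
    by (simp add: cube_monom_def)
  then show ?case
    by (simp add: cube_monom_in_deg_le)
next
  case (insert j J)
  have "(\<lambda>x. of_bool (x \<in> cube n) * (\<Prod>j\<in>insert j J. G j x)) =
     (\<lambda>x. of_bool (x \<in> cube n) * G j x) * (\<lambda>x. of_bool (x \<in> cube n) * (\<Prod>j\<in>J. G j x))"
    using insert by (auto simp: fun_eq_iff)
  then show ?case
    using insert deg_le_mult by simp
qed

text \<open>Substituting coordinates of degree at most 1 turns a monomial with \<open>r\<close>
  variables into a product of \<open>r\<close> such factors. It serves both complementation and the
  projection to a block.\<close>

lemma deg_le_comp:
  assumes g: "g \<in> deg_le l r"
    and \<phi>: "\<And>x. x \<in> cube n \<Longrightarrow> \<phi> x \<in> cube l"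
    and coord: "\<And>i. i < l \<Longrightarrow> (\<lambda>x. of_bool (x \<in> cube n) * \<phi> x i) \<in> deg_le n 1"
  shows "(\<lambda>x. of_bool (x \<in> cube n) * g (\<phi> x)) \<in> deg_le n r"
proof -
  let ?E = "\<lambda>(g :: (nat \<Rightarrow> bit) \<Rightarrow> bit) x. of_bool (x \<in> cube n) * g (\<phi> x)"
  have "?E (cube_monom l S) \<in> deg_le n r" if S: "S \<subseteq> {..<l}" "card S \<le> r" for S
  proof -
    have "?E (cube_monom l S) = (\<lambda>x. of_bool (x \<in> cube n) * (\<Prod>i\<in>S. \<phi> x i))"
      using \<phi> by (auto simp: cube_monom_def fun_eq_iff)
    also have "\<dots> \<in> deg_le n (\<Sum>i\<in>S. 1)"
      using S coord finite_subset by (intro deg_le_prod) auto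
    also have "\<dots> \<subseteq> deg_le n r"
      using S by (intro deg_le_mono) simp
    finally show ?thesis .
  qed
  moreover have "bf.subspace {g. ?E g \<in> deg_le n r}"
  proof (rule bit_subspaceI)
    fix g h assume "g \<in> {g. ?E g \<in> deg_le n r}" "h \<in> {g. ?E g \<in> deg_le n r}"
    moreover have "?E (g + h) = ?E g + ?E h"
      by (rule ext) (simp only: plus_fun_apply distrib_left)
    ultimately show "g + h \<in> {g. ?E g \<in> deg_le n r}"
      using deg_le_add by auto
  next
    have "?E 0 = 0"
      by (simp add: fun_eq_iff)
    then show "0 \<in> {g. ?E g \<in> deg_le n r}"
      by (simp add: deg_le_0)
  qed
  ultimately show ?thesis
    using deg_le_induct[OF g] by blast
qed

section \<open>Uniqueness and interpolation from the points of low weight\<close>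

definition ind :: "nat \<Rightarrow> nat set \<Rightarrow> nat \<Rightarrow> bit" where
  "ind n T = (\<lambda>i\<in>{..<n}. of_bool (i \<in> T))"

lemma ind_in_cube: "ind n T \<in> cube n"
  by (simp add: ind_def cube_def)

lemma cube_eq_ind: "x \<in> cube n \<Longrightarrow> x = ind n {i. i < n \<and> x i = 1}"
  by (rule ext) (auto simp: ind_def cube_def restrict_def PiE_def extensional_def)

lemma weight_ind: "T \<subseteq> {..<n} \<Longrightarrow> weight n (ind n T) = card T"
  unfolding weight_def ind_def by (rule arg_cong[of _ _ card]) auto

lemma cube_cases:
  assumes "x \<in> cube n"
  obtains T where "T \<subseteq> {..<n}" "x = ind n T" "weight n x = card T"
proof -
  have "{i. i < n \<and> x i = 1} \<subseteq> {..<n}"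
    by auto
  then show thesis
    using that cube_eq_ind[OF assms] by (metis weight_ind)
qed

lemma cube_monom_ind:
  assumes "S \<subseteq> {..<n}"
  shows "cube_monom n S (ind n T) = of_bool (S \<subseteq> T)"
proof -
  have "finite S"
    using assms finite_subset by blast
  then have "(\<Prod>i\<in>S. ind n T i) = of_bool (S \<subseteq> T)"
    using assms by (induction S) (auto simp: ind_def)
  then show ?thesis
    by (simp add: cube_monom_def ind_in_cube)
qed

text \<open>The evaluation matrix is unitriangular for inclusion: the monomial of \<open>S\<close>
  is 1 at \<open>ind n T\<close> exactly if \<open>S \<subseteq> T\<close>. At
  \<open>ind n S\<close> the proper subsets drop out by induction and all other sets evaluate to 0,
  leaving \<open>c S\<close>.\<close>

lemma cube_monom_sum_eq_0D:
  assumes "\<S> \<subseteq> Pow {..<n}"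
    and zero: "\<And>T. T \<in> \<S> \<Longrightarrow> (\<Sum>S\<in>\<S>. c S * cube_monom n S (ind n T)) = 0"
    and "S \<in> \<S>"
  shows "c S = 0"
  using \<open>S \<in> \<S>\<close>
proof (induction "card S" arbitrary: S rule: less_induct)
  case less
  have fin: "finite \<S>"
    using assms(1) finite_subset by blast
  have "c T * cube_monom n T (ind n S) = 0" if T: "T \<in> \<S>" "T \<noteq> S" for T
  proof (cases "T \<subseteq> S")
    case True
    moreover have "finite S"
      using less.prems assms(1) finite_subset by (metis PowD finite_lessThan subsetD)
    ultimately have "c T = 0"
      using T by (intro less.hyps psubset_card_mono) auto
    then show ?thesis
      by simp
  next
    case False
    then show ?thesis
      using T assms(1) by (simp add: cube_monom_ind subset_iff)
  qed
  then have "(\<Sum>T\<in>\<S> - {S}. c T * cube_monom n T (ind n S)) = 0"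
    by (intro sum.neutral) blast
  then have "(\<Sum>T\<in>\<S>. c T * cube_monom n T (ind n S)) = c S * cube_monom n S (ind n S)"
    by (simp only: sum.remove[OF fin less.prems] add_0_right)
  then show ?case
    using zero[OF less.prems] less.prems assms(1) by (auto simp: cube_monom_ind)
qed

lemma inj_on_cube_monom: "inj_on (cube_monom n) (Pow {..<n})"
proof (rule inj_onI)
  fix S T assume "S \<in> Pow {..<n}" "T \<in> Pow {..<n}" and eq: "cube_monom n S = cube_monom n T"
  then have "(of_bool (S \<subseteq> U) :: bit) = of_bool (T \<subseteq> U)" for U
    using cube_monom_ind[of S n U] cube_monom_ind[of T n U] by simp
  from this[of S] this[of T] show "S = T"
    by auto
qed

lemma independent_cube_monom: "bf.independent (cube_monom n ` Pow {..<n})"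
proof -
  let ?B = "cube_monom n ` Pow {..<n}"
  have zero: "f g = 0" if rel: "(\<Sum>g\<in>?B. bit_scale (f g) g) = 0" and g: "g \<in> ?B" for f g
  proof -
    have "(\<Sum>S\<in>Pow {..<n}. f (cube_monom n S) * cube_monom n S x) = 0" for x
      using fun_cong[OF rel, of x]
      by (simp add: sum.reindex[OF inj_on_cube_monom] sum_fun_apply)
    then have "f (cube_monom n S) = 0" if "S \<in> Pow {..<n}" for S
      using cube_monom_sum_eq_0D[of "Pow {..<n}" n "\<lambda>S. f (cube_monom n S)" S] that by simp
    then show ?thesis
      using g by blast
  qed
  have "finite ?B"
    by simp
  show ?thesis
  proof
    assume "bf.dependent ?B"
    then obtain f where "(\<Sum>g\<in>?B. bit_scale (f g) g) = 0" "\<exists>g\<in>?B. f g \<noteq> 0"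
      unfolding bf.dependent_finite[OF \<open>finite ?B\<close>] by blast
    with zero[of f] show False
      by blast
  qed
qed

text \<open>The points of weight at most \<open>r\<close> are the \<open>ind n T\<close> for exactly
  those \<open>T\<close> that index the monomials, so the triangular system applies.\<close>

lemma deg_le_eq_0:
  assumes g: "g \<in> deg_le n r" and zero: "\<And>x. x \<in> cube n \<Longrightarrow> weight n x \<le> r \<Longrightarrow> g x = 0"
  shows "g = 0"
proof -
  let ?S = "{S. S \<subseteq> {..<n} \<and> card S \<le> r}"
  have fin: "finite ?S"
    by (rule finite_subset[of _ "Pow {..<n}"]) auto
  have inj: "inj_on (cube_monom n) ?S"
    by (rule inj_on_subset[OF inj_on_cube_monom]) auto
  obtain c where "g = (\<Sum>h\<in>cube_monom n ` ?S. bit_scale (c h) h)"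
    using g fin unfolding deg_le_def by (subst (asm) bf.span_finite) auto
  then have c: "g = (\<Sum>S\<in>?S. bit_scale (c (cube_monom n S)) (cube_monom n S))"
    by (simp add: sum.reindex[OF inj])
  have "c (cube_monom n S) = 0" if "S \<in> ?S" for S
  proof (rule cube_monom_sum_eq_0D[of ?S n "\<lambda>S. c (cube_monom n S)"])
    fix T assume "T \<in> ?S"
    then have "g (ind n T) = 0"
      by (intro zero) (auto simp: ind_in_cube weight_ind)
    then show "(\<Sum>S\<in>?S. c (cube_monom n S) * cube_monom n S (ind n T)) = 0"
      by (simp add: c sum_fun_apply)
  qed (use that in auto)
  then have "(\<Sum>S\<in>?S. bit_scale (c (cube_monom n S)) (cube_monom n S)) = 0"
    by (intro sum.neutral ballI) simp
  with c show ?thesis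
    by (rule trans)
qed

text \<open>Induction over the weight: the monomials of size \<open>r + 1\<close> vanish on lower
  weights and repair the values at weight \<open>r + 1\<close> one point at a time.\<close>

lemma deg_le_interpolate:
  "\<exists>g\<in>deg_le n r. \<forall>x\<in>cube n. weight n x \<le> r \<longrightarrow> g x = h x"
proof (induction r)
  case 0
  have "bit_scale (h (ind n {})) (cube_monom n {}) \<in> deg_le n 0"
    by (intro bf.subspace_scale[OF subspace_deg_le] cube_monom_in_deg_le) auto
  moreover have "bit_scale (h (ind n {})) (cube_monom n {}) x = h x" if "x \<in> cube n" "weight n x \<le> 0" for x
    using that(1)
  proof (cases rule: cube_cases)
    case (1 T)
    then have "T = {}"
      using that by (metis card_0_eq finite_lessThan finite_subset le_zero_eq)
    then show ?thesis
      using 1 by (simp add: cube_monom_ind)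
  qed
  ultimately show ?case
    by blast
next
  case (Suc r)
  then obtain g where g: "g \<in> deg_le n r" "\<And>x. x \<in> cube n \<Longrightarrow> weight n x \<le> r \<Longrightarrow> g x = h x"
    by blast
  let ?S = "{S. S \<subseteq> {..<n} \<and> card S = Suc r}"
  have fin: "finite ?S"
    by (rule finite_subset[of _ "Pow {..<n}"]) auto
  \<comment> \<open>In characteristic 2 the sum \<open>g + h\<close> is the error of
    \<open>g\<close>; adding it at the matching point turns \<open>g\<close> into
    \<open>h\<close>.\<close>
  define g' where "g' = g + (\<Sum>S\<in>?S. bit_scale (g (ind n S) + h (ind n S)) (cube_monom n S))"
  have "g' \<in> deg_le n (Suc r)"
    unfolding g'_def using g(1) deg_le_mono[of r "Suc r" n]
    by (intro deg_le_add deg_le_sum bf.subspace_scale[OF subspace_deg_le] cube_monom_in_deg_le) auto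
  moreover have "g' x = h x" if "x \<in> cube n" "weight n x \<le> Suc r" for x
    using that(1)
  proof (cases rule: cube_cases)
    case (1 T)
    have finT: "finite T"
      using 1(1) finite_subset by blast
    have sub: "S \<subseteq> T \<longleftrightarrow> S = T" if "S \<in> ?S" for S
      using that 1 \<open>weight n x \<le> Suc r\<close> card_seteq[OF finT, of S] by auto
    have "g' x = g x + (\<Sum>S\<in>?S. (g (ind n S) + h (ind n S)) * cube_monom n S x)"
      by (simp only: g'_def plus_fun_apply sum_fun_apply bit_scale_apply)
    also have "(\<Sum>S\<in>?S. (g (ind n S) + h (ind n S)) * cube_monom n S x) =
        (\<Sum>S\<in>?S. if S = T then g (ind n S) + h (ind n S) else 0)"
      using sub by (intro sum.cong) (auto simp: 1(2) cube_monom_ind)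
    also have "\<dots> = (if T \<in> ?S then g x + h x else 0)"
      using fin by (simp only: sum.delta 1(2))
    also have "g x + \<dots> = h x"
    proof (cases "T \<in> ?S")
      case True
      then show ?thesis
        by (simp only: if_True bit_add_self_left)
    next
      case False
      then have "weight n x \<le> r"
        using 1 \<open>weight n x \<le> Suc r\<close> by simp
      then show ?thesis
        using False g(2)[OF that(1)] by simp
    qed
    finally show ?thesis .
  qed
  ultimately show ?case
    by blast
qed

lemma weight_le: "weight n x \<le> n"
proof -
  have "weight n x \<le> card {..<n}"
    unfolding weight_def by (rule card_mono) auto
  then show ?thesis
    by simp
qed

text \<open>For \<open>r = n\<close> the weight bound in the interpolation holds at every point of
  the cube.\<close>

lemma deg_le_full:
  assumes "\<And>x. x \<notin> cube n \<Longrightarrow> h x = 0"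
  shows "h \<in> deg_le n n"
proof -
  obtain g where g: "g \<in> deg_le n n" "\<forall>x\<in>cube n. weight n x \<le> n \<longrightarrow> g x = h x"
    using deg_le_interpolate[of n n h] by blast
  then have "g = h"
    using assms deg_le_outside[OF g(1)] weight_le by (intro ext) metis
  then show ?thesis
    using g(1) by simp
qed

section \<open>Complementation, which exchanges low and high weights\<close>

definition cpl :: "nat \<Rightarrow> (nat \<Rightarrow> bit) \<Rightarrow> nat \<Rightarrow> bit" where
  "cpl n x = (\<lambda>i\<in>{..<n}. x i + 1)"

lemma cpl_in_cube: "cpl n x \<in> cube n"
  by (simp add: cpl_def cube_def)

lemma cpl_cpl: "x \<in> cube n \<Longrightarrow> cpl n (cpl n x) = x"
  by (rule ext) (auto simp: cpl_def cube_def PiE_def extensional_def add.assoc)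

lemma weight_cpl: "weight n (cpl n x) = n - weight n x"
proof -
  have "{j. j < n \<and> cpl n x j = 1} = {..<n} - {j. j < n \<and> x j = 1}"
    by (auto simp: cpl_def)
  then show ?thesis
    unfolding weight_def by (simp add: card_Diff_subset subset_iff)
qed

lemma deg_le_cpl:
  assumes "g \<in> deg_le n r"
  shows "(\<lambda>x. of_bool (x \<in> cube n) * g (cpl n x)) \<in> deg_le n r"
proof (rule deg_le_comp[OF assms cpl_in_cube])
  fix i assume i: "i < n"
  have "(\<lambda>x. of_bool (x \<in> cube n) * cpl n x i) = cube_monom n {i} + cube_monom n {}"
    using i by (auto simp: fun_eq_iff cpl_def cube_monom_def)
  also have "\<dots> \<in> deg_le n 1"
    using i by (intro deg_le_add cube_monom_in_deg_le) auto
  finally show "(\<lambda>x. of_bool (x \<in> cube n) * cpl n x i) \<in> deg_le n 1" .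
qed

text \<open>Complementation is affine, so it preserves degrees and carries the statement for low
  weights to high weights.\<close>

lemma deg_le_eq_0_high:
  assumes g: "g \<in> deg_le n r" and zero: "\<And>x. x \<in> cube n \<Longrightarrow> n \<le> weight n x + r \<Longrightarrow> g x = 0"
  shows "g = 0"
proof -
  have "(\<lambda>x. of_bool (x \<in> cube n) * g (cpl n x)) = 0"
  proof (rule deg_le_eq_0[OF deg_le_cpl[OF g]])
    fix x assume "x \<in> cube n" "weight n x \<le> r"
    then have "g (cpl n x) = 0"
      using weight_le[of n x] by (intro zero cpl_in_cube) (simp add: weight_cpl)
    then show "of_bool (x \<in> cube n) * g (cpl n x) = 0"
      by simp
  qed
  then have *: "g (cpl n x) = 0" if "x \<in> cube n" for x
    using that by (auto simp: fun_eq_iff)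
  show ?thesis
  proof (rule ext)
    fix x
    show "g x = 0 x"
      using *[OF cpl_in_cube[of n x]] deg_le_outside[OF g, of x] by (cases "x \<in> cube n") (auto simp: cpl_cpl)
  qed
qed

lemma deg_le_interpolate_high:
  "\<exists>g\<in>deg_le n r. \<forall>x\<in>cube n. n \<le> weight n x + r \<longrightarrow> g x = h x"
proof -
  obtain g where g: "g \<in> deg_le n r" "\<forall>x\<in>cube n. weight n x \<le> r \<longrightarrow> g x = h (cpl n x)"
    using deg_le_interpolate[of n r "\<lambda>x. h (cpl n x)"] by blast
  have "of_bool (x \<in> cube n) * g (cpl n x) = h x" if "x \<in> cube n" "n \<le> weight n x + r" for x
    using that g(2) cpl_in_cube[of n x] by (simp add: weight_cpl cpl_cpl)
  with deg_le_cpl[OF g(1)] show ?thesis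
    by (intro bexI[of _ "\<lambda>x. of_bool (x \<in> cube n) * g (cpl n x)"]) simp_all
qed

section \<open>A pair basis for one block\<close>

lemma bf_card_le:
  assumes "bf.independent S" "S \<subseteq> bf.span T" "finite T"
  shows "card S \<le> card T"
  by (rule conjunct2[OF bf.independent_span_bound[OF assms(3,1,2)]])

lemma span_mult_image:
  assumes "w \<in> bf.span S"
  shows "f * w \<in> bf.span ((\<lambda>v. f * v) ` S)"
proof (rule bf.span_induct[OF assms])
  show "bf.subspace {w. f * w \<in> bf.span ((\<lambda>v. f * v) ` S)}"
    by (rule bit_subspaceI) (auto simp: distrib_left bf.span_zero bf.span_add)
next
  fix v assume "v \<in> S"
  then show "f * v \<in> bf.span ((\<lambda>v. f * v) ` S)"
    by (intro bf.span_base imageI)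
qed

text \<open>Coefficients are attached to the indices in \<open>J\<close>, so \<open>\<phi>\<close>
  may take the same value twice.\<close>

lemma span_image_sum:
  assumes "finite J" "g \<in> bf.span (\<phi> ` J)"
  obtains c where "g = (\<Sum>j\<in>J. bit_scale (c j) (\<phi> j))"
proof -
  define comb where "comb c = (\<Sum>j\<in>J. bit_scale (c j) (\<phi> j))" for c
  have "bf.span (\<phi> ` J) \<subseteq> range comb"
  proof (rule bf.span_minimal)
    show "bf.subspace (range comb)"
    proof (rule bit_subspaceI)
      have "0 = comb (\<lambda>_. 0)"
        by (simp add: comb_def)
      then show "0 \<in> range comb"
        by (rule range_eqI[of _ comb])
    next
      fix g h assume "g \<in> range comb" "h \<in> range comb"
      then obtain c c' where "g = comb c" "h = comb c'"
        by (elim rangeE)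
      then have "g + h = comb (\<lambda>j. c j + c' j)"
        by (simp add: comb_def bf.scale_left_distrib sum.distrib)
      then show "g + h \<in> range comb"
        by (rule range_eqI[of _ comb])
    qed
    show "\<phi> ` J \<subseteq> range comb"
    proof
      fix g assume "g \<in> \<phi> ` J"
      then obtain i where i: "i \<in> J" "g = \<phi> i"
        by (elim imageE)
      have "comb (\<lambda>j. if j = i then 1 else 0) = (\<Sum>j\<in>J. if j = i then \<phi> j else 0)"
        unfolding comb_def by (intro sum.cong) auto
      also have "\<dots> = g"
        using i assms(1) by simp
      finally show "g \<in> range comb"
        by (rule range_eqI[of _ comb, OF sym])
    qed
  qed
  then have "g \<in> range comb"
    using assms(2) by (rule subsetD)
  then show thesis
    by (elim rangeE) (use that in \<open>simp add: comb_def\<close>)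
qed

lemma card_subsets_le: "card {S. S \<subseteq> {..<n} \<and> card S \<le> r} = (\<Sum>i\<le>r. n choose i)"
proof -
  have "{S. S \<subseteq> {..<n} \<and> card S \<le> r} = (\<Union>i\<in>{..r}. {S. S \<subseteq> {..<n} \<and> card S = i})"
    by auto
  moreover have "finite {S. S \<subseteq> {..<n} \<and> card S = i}" for i
    by (rule finite_subset[of _ "Pow {..<n}"]) auto
  ultimately show ?thesis
    by (simp only:) (subst card_UN_disjoint, auto simp: n_subsets)
qed

text \<open>Supplies the finiteness of \<open>V\<close> on which the minimality argument of
  \<open>bifiltered_basis\<close> rests.\<close>

lemma finite_deg_le: "finite (deg_le n r)"
proof -
  have "deg_le n r \<subseteq> {g. \<forall>x. (x \<in> cube n \<longrightarrow> g x \<in> UNIV) \<and> (x \<notin> cube n \<longrightarrow> g x = 0)}"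
    using deg_le_outside by auto
  moreover have "finite (UNIV :: bit set)"
    unfolding UNIV_bit by simp
  note finite_set_of_finite_funs[OF finite_cube this]
  ultimately show ?thesis
    by (rule finite_subset)
qed

text \<open>The elements \<open>A\<close> and \<open>f * A\<close> span every
  \<open>deg_le l r\<close> through those of level at most \<open>r\<close>. With
  \<open>2 * card X = 2 ^ l\<close>, the dimension of the space, this makes them a basis;
  independence is recovered by counting in \<open>prod_elem_irredundant\<close>.\<close>

locale block_basis =
  fixes l :: nat and f :: "(nat \<Rightarrow> bit) \<Rightarrow> bit"
    and X :: "((nat \<Rightarrow> bit) \<Rightarrow> bit) set" and a b :: "((nat \<Rightarrow> bit) \<Rightarrow> bit) \<Rightarrow> nat"
  assumes finite_X: "finite X" and card_X: "2 * card X = 2 ^ l"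
    and deg_a: "A \<in> X \<Longrightarrow> A \<in> deg_le l (a A)"
    and deg_b: "A \<in> X \<Longrightarrow> f * A \<in> deg_le l (b A)"
    and deg_le_span: "g \<in> deg_le l r \<Longrightarrow>
      g \<in> bf.span ({A \<in> X. a A \<le> r} \<union> (\<lambda>A. f * A) ` {A \<in> X. b A \<le> r})"

section \<open>The pair basis for majority and its bad elements\<close>

lemma maj_low: "2 * weight l x < l + 1 \<Longrightarrow> odd l \<Longrightarrow> maj l x = 0"
  by (auto simp: maj_def elim!: oddE)

lemma maj_high: "2 * weight l x \<ge> l + 1 \<Longrightarrow> odd l \<Longrightarrow> maj l x = 1"
  by (auto simp: maj_def elim!: oddE)

lemma maj_block_basis:
  assumes l: "l = 2 * m + 1"
  obtains X a b where "block_basis l (maj l) X a b"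
    and "card {A \<in> X. b A \<le> a A + d} \<le> d * (l choose m)"
proof -
  let ?f = "maj l"
  have odd: "odd l"
    using l by simp
  have f_low: "?f x = 0" if "weight l x \<le> m" for x
    using that odd l by (intro maj_low) auto
  have f_high: "?f x = 1" if "l \<le> weight l x + m" for x
    using that odd l by (intro maj_high) auto
  have low_high: "weight l x \<le> m \<or> l \<le> weight l x + m" for x
    using l by auto
  \<comment> \<open>The second filtration: functions are ranked by the degree of their product with
    majority. At level \<open>l\<close> it contains every function supported on the cube.\<close>
  define Q where "Q j = {v. ?f * v \<in> deg_le l j}" for j
  have subQ: "bf.subspace (Q j)" for j
    unfolding Q_def by (rule bit_subspaceI) (auto simp: distrib_left deg_le_0 deg_le_add)
  have monoQ: "mono Q"
    using deg_le_mono[of _ _ l] by (intro monoI) (auto simp: Q_def)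
  have VQ: "v \<in> Q l" if "v \<in> deg_le l m" for v
    unfolding Q_def using deg_le_outside[OF that] by (auto intro: deg_le_full)
  have "\<exists>X \<subseteq> deg_le l m. bf.independent X \<and> (\<forall>v\<in>deg_le l m. \<forall>i j.
      v \<in> deg_le l i \<longrightarrow> v \<in> Q j \<longrightarrow> v \<in> bf.span (X \<inter> deg_le l i \<inter> Q j))"
    using VQ by (intro bf.bifiltered_basis finite_deg_le subspace_deg_le mono_deg_le subQ monoQ) auto
  then obtain X where XV: "X \<subseteq> deg_le l m" and indep: "bf.independent X"
    and spanX': "\<forall>v\<in>deg_le l m. \<forall>i j.
      v \<in> deg_le l i \<longrightarrow> v \<in> Q j \<longrightarrow> v \<in> bf.span (X \<inter> deg_le l i \<inter> Q j)"
    by (elim exE conjE)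
  have spanX: "v \<in> bf.span (X \<inter> deg_le l i \<inter> Q j)"
    if "v \<in> deg_le l m" "v \<in> deg_le l i" "v \<in> Q j" for v i j
    using spanX' that by simp
  define a where "a A = (LEAST i. A \<in> deg_le l i)" for A
  define b where "b A = (LEAST j. A \<in> Q j)" for A
  have a: "A \<in> deg_le l i \<longleftrightarrow> a A \<le> i" if "A \<in> X" for A i
    using that XV mono_deg_le[of l] unfolding a_def
    by (metis (no_types, lifting) LeastI Least_le monoD subsetD)
  have b: "A \<in> Q j \<longleftrightarrow> b A \<le> j" if "A \<in> X" for A j
    using that XV monoQ VQ unfolding b_def
    by (metis (no_types, lifting) LeastI Least_le monoD subsetD)
  have finX: "finite X"
    using XV finite_deg_le finite_subset by blast
  \<comment> \<open>The elements of \<open>X\<close> in \<open>deg_le l r\<close> and the monomials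
    of degree at most \<open>r\<close> are independent sets spanning the same space.\<close>
  have card_Xr: "card (X \<inter> deg_le l r) = (\<Sum>i\<le>r. l choose i)" if "r \<le> m" for r
  proof -
    let ?M = "cube_monom l ` {S. S \<subseteq> {..<l} \<and> card S \<le> r}"
    have fin: "finite {S. S \<subseteq> {..<l} \<and> card S \<le> r}"
      by (rule finite_subset[of _ "Pow {..<l}"]) auto
    have "card ?M = card {S. S \<subseteq> {..<l} \<and> card S \<le> r}"
      by (rule card_image) (rule inj_on_subset[OF inj_on_cube_monom], auto)
    moreover have "card (X \<inter> deg_le l r) \<le> card ?M"
    proof -
      have "bf.independent (X \<inter> deg_le l r)"
        by (rule bf.independent_mono[OF indep]) simp
      moreover have "X \<inter> deg_le l r \<subseteq> bf.span ?M"
        by (simp add: deg_le_def)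
      ultimately show ?thesis
        using finite_imageI[OF fin] by (rule bf_card_le)
    qed
    moreover have "card ?M \<le> card (X \<inter> deg_le l r)"
    proof -
      have "bf.independent ?M"
        by (rule bf.independent_mono[OF independent_cube_monom]) auto
      moreover have "?M \<subseteq> bf.span (X \<inter> deg_le l r)"
      proof
        fix g assume "g \<in> ?M"
        then have g: "g \<in> deg_le l r"
          using cube_monom_in_deg_le by auto
        moreover have "g \<in> deg_le l m"
          using g deg_le_mono[OF that] by (rule subsetD[rotated])
        ultimately have "g \<in> bf.span (X \<inter> deg_le l r \<inter> Q l)"
          by (intro spanX VQ)
        then show "g \<in> bf.span (X \<inter> deg_le l r)"
          by (rule subsetD[OF bf.span_mono, rotated]) auto
      qed
      ultimately show ?thesis
        using finite_Int[OF disjI1[OF finX]] by (rule bf_card_le)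
    qed
    ultimately show ?thesis
      by (simp add: card_subsets_le)
  qed
  have card_X: "card X = (\<Sum>i\<le>m. l choose i)"
    using card_Xr[of m] XV by (simp add: Int_absorb2)
  \<comment> \<open>If \<open>maj l * A\<close> had degree at most \<open>m\<close>, its vanishing
    on low weights would make it zero. Then \<open>A\<close> would vanish on high weights, hence be
    zero, against independence.\<close>
  have b_gt: "m < b A" if "A \<in> X" for A
  proof (rule ccontr)
    assume "\<not> m < b A"
    then have "?f * A \<in> deg_le l m"
      using b[OF that, of m] by (simp add: Q_def)
    then have fA: "?f * A = 0"
      by (rule deg_le_eq_0) (simp add: f_low)
    have "A = 0"
    proof (rule deg_le_eq_0_high[of _ l m])
      fix x assume "x \<in> cube l" "l \<le> weight l x + m"
      then show "A x = 0"
        using fun_cong[OF fA, of x] f_high[of x] by simp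
    qed (use that XV in auto)
    then show False
      using that indep bf.dependent_zero[of X] by simp
  qed
  have span: "g \<in> bf.span ({A \<in> X. a A \<le> r} \<union> (\<lambda>A. ?f * A) ` {A \<in> X. b A \<le> r})"
    if g: "g \<in> deg_le l r" for g r
  proof -
    let ?S = "{A \<in> X. a A \<le> r} \<union> (\<lambda>A. ?f * A) ` {A \<in> X. b A \<le> r}"
    have low: "v \<in> bf.span ?S" if "v \<in> deg_le l m" "v \<in> deg_le l r" for v
    proof -
      have "v \<in> bf.span (X \<inter> deg_le l r \<inter> Q l)"
        using that by (intro spanX VQ)
      moreover have "X \<inter> deg_le l r \<inter> Q l \<subseteq> ?S"
        using a by auto
      ultimately show ?thesis
        by (rule subsetD[OF bf.span_mono, rotated])
    qed
    show ?thesis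
    proof (cases "r \<le> m")
      case True
      then show ?thesis
        using low[OF _ g] subsetD[OF deg_le_mono[OF True] g] by simp
    next
      case False
      \<comment> \<open>The decomposition \<open>g = v + maj l * w\<close>: \<open>v\<close> matches
        \<open>g\<close> on low weights, where majority is 0, and \<open>w\<close> matches
        \<open>g + v\<close> on high weights, where majority is 1. As \<open>v\<close> and
        \<open>g\<close> have degree at most \<open>r\<close>, so does \<open>maj l * w\<close>,
        which puts \<open>w\<close> into \<open>Q r\<close>.\<close>
      obtain v where v: "v \<in> deg_le l m" "\<forall>x\<in>cube l. weight l x \<le> m \<longrightarrow> v x = g x"
        using deg_le_interpolate[of l m g] by (elim bexE)
      obtain w where w: "w \<in> deg_le l m" "\<forall>x\<in>cube l. l \<le> weight l x + m \<longrightarrow> w x = (g + v) x"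
        using deg_le_interpolate_high[of l m "g + v"] by (elim bexE)
      have vr: "v \<in> deg_le l r"
        using v(1) deg_le_mono[of m r l] False by auto
      have fw: "?f * w = g + v"
      proof
        fix x
        show "(?f * w) x = (g + v) x"
        proof (cases "x \<in> cube l")
          case True
          then show ?thesis
            using low_high[of x] f_low[of x] f_high[of x] v(2) w(2) by auto
        next
          case False
          then show ?thesis
            using deg_le_outside[OF g] deg_le_outside[OF v(1)] deg_le_outside[OF w(1)] by simp
        qed
      qed
      then have "w \<in> Q r"
        using g vr deg_le_add by (simp add: Q_def)
      then have "w \<in> bf.span (X \<inter> deg_le l m \<inter> Q r)"
        using w(1) by (intro spanX)
      then have "?f * w \<in> bf.span ((\<lambda>A. ?f * A) ` (X \<inter> deg_le l m \<inter> Q r))"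
        by (rule span_mult_image)
      moreover have "(\<lambda>A. ?f * A) ` (X \<inter> deg_le l m \<inter> Q r) \<subseteq> ?S"
        using b by auto
      ultimately have "g + v \<in> bf.span ?S"
        unfolding fw by (rule subsetD[OF bf.span_mono, rotated])
      then have "(g + v) + v \<in> bf.span ?S"
        using low[OF v(1) vr] by (rule bf.span_add)
      then show ?thesis
        by (simp add: add.assoc)
    qed
  qed
  \<comment> \<open>Half of an odd row of Pascal's triangle, by symmetry.\<close>
  have "(\<Sum>i\<le>m. l choose i) = 2 ^ (2 * m)"
    unfolding l by (rule binomial_r_part_sum)
  then have two_card_X: "2 * card X = 2 ^ l"
    by (simp add: card_X l)
  have basis: "block_basis l ?f X a b"
  proof unfold_locales
    show "A \<in> deg_le l (a A)" if "A \<in> X" for A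
      using a[OF that] by simp
    show "?f * A \<in> deg_le l (b A)" if "A \<in> X" for A
      using b[OF that, of "b A"] by (simp add: Q_def)
  qed (fact finX two_card_X span)+
  have le: "(\<Sum>i\<in>J. l choose i) \<le> card J * (l choose m)" if "J \<subseteq> {..m}" for J
  proof -
    have "l choose i \<le> l choose m" if "i \<in> J" for i
      using that \<open>J \<subseteq> {..m}\<close> l by (intro binomial_mono) auto
    then show ?thesis
      using sum_bounded_above[of J "\<lambda>i. l choose i" "l choose m"] by simp
  qed
  \<comment> \<open>A bad \<open>A\<close> satisfies \<open>m < b A \<le> a A + d\<close>, so for
    \<open>d \<le> m\<close> it lies outside \<open>deg_le l (m - d)\<close>. The rest of
    \<open>X\<close> is counted by the \<open>d\<close> binomials with index from
    \<open>m - d + 1\<close> to \<open>m\<close>. For \<open>d > m\<close> all of \<open>X\<close>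
    is counted, by \<open>m + 1 \<le> d\<close> binomials.\<close>
  have "card {A \<in> X. b A \<le> a A + d} \<le> d * (l choose m)"
  proof (cases "d \<le> m")
    case True
    have "{A \<in> X. b A \<le> a A + d} \<subseteq> X - (X \<inter> deg_le l (m - d))"
      using a b_gt True by fastforce
    then have "card {A \<in> X. b A \<le> a A + d} \<le> card (X - (X \<inter> deg_le l (m - d)))"
      using finX by (intro card_mono) auto
    also have "\<dots> = (\<Sum>i\<le>m. l choose i) - (\<Sum>i\<le>m-d. l choose i)"
      using finX card_Xr[of "m - d"] by (subst card_Diff_subset) (auto simp: card_X)
    also have "\<dots> = (\<Sum>i\<in>{..m} - {..m-d}. l choose i)"
      by (subst sum_diff_nat) auto
    also have "\<dots> \<le> card ({..m} - {..m-d}) * (l choose m)"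
      by (rule le) auto
    also have "card ({..m} - {..m-d}) = d"
      using True by (subst card_Diff_subset) auto
    finally show ?thesis .
  next
    case False
    have "card {A \<in> X. b A \<le> a A + d} \<le> card X"
      using finX by (intro card_mono) auto
    also have "\<dots> \<le> card {..m} * (l choose m)"
      unfolding card_X by (rule le) simp
    also have "\<dots> \<le> d * (l choose m)"
      using False by (intro mult_right_mono) auto
    finally show ?thesis .
  qed
  with basis show thesis
    by (rule that)
qed

section \<open>Products of pair bases\<close>

lemma block_in_cube: "block l j x \<in> cube l"
  by (simp add: block_def cube_def)

context block_basis
begin

lemma l_pos: "0 < l"
proof (rule ccontr)
  assume "\<not> 0 < l"
  then have "2 * card X = 1"
    using card_X by simp
  then show False
    by simp
qed

text \<open>Basis elements are named by formal pairs, the flag telling \<open>f * A\<close> from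
  \<open>A\<close>, so that both parts remain readable from the name.\<close>

definition elem :: "((nat \<Rightarrow> bit) \<Rightarrow> bit) \<times> bool \<Rightarrow> (nat \<Rightarrow> bit) \<Rightarrow> bit" where
  "elem e = (if snd e then f * fst e else fst e)"

definition lev :: "((nat \<Rightarrow> bit) \<Rightarrow> bit) \<times> bool \<Rightarrow> nat" where
  "lev e = (if snd e then b (fst e) else a (fst e))"

definition idx :: "nat \<Rightarrow> (nat \<Rightarrow> ((nat \<Rightarrow> bit) \<Rightarrow> bit) \<times> bool) set" where
  "idx k = PiE {..<k} (\<lambda>_. X \<times> UNIV)"

definition prod_elem :: "nat \<Rightarrow> (nat \<Rightarrow> ((nat \<Rightarrow> bit) \<Rightarrow> bit) \<times> bool) \<Rightarrow> (nat \<Rightarrow> bit) \<Rightarrow> bit" where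
  "prod_elem k \<omega> = (\<lambda>x. of_bool (x \<in> cube (k * l)) * (\<Prod>j<k. elem (\<omega> j) (block l j x)))"

definition prod_lev :: "nat \<Rightarrow> (nat \<Rightarrow> ((nat \<Rightarrow> bit) \<Rightarrow> bit) \<times> bool) \<Rightarrow> nat" where
  "prod_lev k \<omega> = (\<Sum>j<k. lev (\<omega> j))"

text \<open>The effect on names of multiplying by \<open>f\<close> in block
  \<open>j\<close>.\<close>

definition raise :: "nat \<Rightarrow> (nat \<Rightarrow> ((nat \<Rightarrow> bit) \<Rightarrow> bit) \<times> bool) \<Rightarrow>
    nat \<Rightarrow> ((nat \<Rightarrow> bit) \<Rightarrow> bit) \<times> bool" where
  "raise j \<omega> = fun_upd \<omega> j (fst (\<omega> j), True)"

lemma finite_idx: "finite (idx k)"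
  unfolding idx_def using finite_X by (intro finite_PiE) auto

lemma card_idx: "card (idx k) = 2 ^ (k * l)"
proof -
  have "card (idx k) = (card X * 2) ^ k"
    unfolding idx_def using finite_X by (subst card_PiE) (auto simp: card_cartesian_product)
  also have "card X * 2 = 2 ^ l"
    using card_X by simp
  finally show ?thesis
    by (simp add: power_mult[symmetric] mult.commute)
qed

lemma idx_fst: "\<omega> \<in> idx k \<Longrightarrow> j < k \<Longrightarrow> fst (\<omega> j) \<in> X"
  by (force simp: idx_def PiE_def Pi_def)

lemma elem_in_deg_le: "fst e \<in> X \<Longrightarrow> elem e \<in> deg_le l (lev e)"
  by (simp add: elem_def lev_def deg_a deg_b)

lemma elem_expansion:
  assumes "g \<in> deg_le l r"
  shows "\<exists>c. g = (\<Sum>e\<in>X \<times> UNIV. bit_scale (c e) (elem e)) \<and> (\<forall>e. c e \<noteq> 0 \<longrightarrow> lev e \<le> r)"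
proof -
  let ?J = "{e \<in> X \<times> UNIV. lev e \<le> r}"
  have fin: "finite (X \<times> (UNIV :: bool set))"
    using finite_X by simp
  then have finJ: "finite ?J"
    by (rule rev_finite_subset) auto
  have "{A \<in> X. a A \<le> r} \<union> (\<lambda>A. f * A) ` {A \<in> X. b A \<le> r} \<subseteq> elem ` ?J" (is "?L \<union> ?H \<subseteq> _")
  proof (rule Un_least)
    show "?L \<subseteq> elem ` ?J"
    proof
      fix A assume "A \<in> ?L"
      then show "A \<in> elem ` ?J"
        by (intro image_eqI[of _ _ "(A, False)"]) (simp_all add: elem_def lev_def)
    qed
    show "?H \<subseteq> elem ` ?J"
    proof
      fix g assume "g \<in> ?H"
      then obtain A where "A \<in> X" "b A \<le> r" "g = f * A"
        by auto
      then show "g \<in> elem ` ?J"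
        by (intro image_eqI[of _ _ "(A, True)"]) (simp_all add: elem_def lev_def)
    qed
  qed
  then have "g \<in> bf.span (elem ` ?J)"
    using deg_le_span[OF assms] by (rule subsetD[OF bf.span_mono])
  then obtain c where c: "g = (\<Sum>e\<in>?J. bit_scale (c e) (elem e))"
    by (rule span_image_sum[OF finJ])
  define c' where "c' e = (if lev e \<le> r then c e else 0)" for e
  have "g = (\<Sum>e\<in>X \<times> UNIV. bit_scale (c' e) (elem e))"
    unfolding c using fin by (intro sum.mono_neutral_cong_left) (auto simp: c'_def)
  moreover have "\<forall>e. c' e \<noteq> 0 \<longrightarrow> lev e \<le> r"
    by (auto simp: c'_def split: if_splits)
  ultimately show ?thesis
    by (intro exI conjI)
qed

lemma prod_elem_in_deg_le:
  assumes "\<omega> \<in> idx k"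
  shows "prod_elem k \<omega> \<in> deg_le (k * l) (prod_lev k \<omega>)"
  unfolding prod_elem_def prod_lev_def
proof (rule deg_le_prod)
  fix j assume "j \<in> {..<k}"
  then have j: "j < k"
    by simp
  show "(\<lambda>x. of_bool (x \<in> cube (k * l)) * elem (\<omega> j) (block l j x)) \<in> deg_le (k * l) (lev (\<omega> j))"
  proof (rule deg_le_comp[OF elem_in_deg_le[OF idx_fst[OF assms j]] block_in_cube])
    fix i assume i: "i < l"
    have "(\<lambda>x. of_bool (x \<in> cube (k * l)) * block l j x i) = cube_monom (k * l) {j * l + i}"
      using i by (simp add: block_def cube_monom_def)
    moreover have "j * l + i < k * l"
    proof -
      have "j * l + i < Suc j * l"
        using i by simp
      also have "\<dots> \<le> k * l"
        using j by (intro mult_right_mono) auto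
      finally show ?thesis .
    qed
    ultimately show "(\<lambda>x. of_bool (x \<in> cube (k * l)) * block l j x i) \<in> deg_le (k * l) 1"
      by (simp add: cube_monom_in_deg_le)
  qed
qed simp

section \<open>Products of block elements form a degree-adapted basis\<close>

lemma bij_betw_blocks:
  assumes "S \<subseteq> {..<k * l}"
  shows "bij_betw (\<lambda>(j, t). j * l + t) (SIGMA j:{..<k}. {t. t < l \<and> j * l + t \<in> S}) S"
proof (rule bij_betw_byWitness[of _ "\<lambda>i. (i div l, i mod l)"])
  show "(\<lambda>i. (i div l, i mod l)) ` S \<subseteq> (SIGMA j:{..<k}. {t. t < l \<and> j * l + t \<in> S})"
  proof
    fix y assume "y \<in> (\<lambda>i. (i div l, i mod l)) ` S"
    then obtain i where i: "i \<in> S" "y = (i div l, i mod l)"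
      by blast
    then have "i div l < k"
      using assms l_pos by (intro less_mult_imp_div_less) auto
    then show "y \<in> (SIGMA j:{..<k}. {t. t < l \<and> j * l + t \<in> S})"
      using i l_pos by simp
  qed
qed (use l_pos in auto)

lemma cube_monom_blocks:
  assumes "S \<subseteq> {..<k * l}" and "x \<in> cube (k * l)"
  shows "cube_monom (k * l) S x = (\<Prod>j<k. cube_monom l {t. t < l \<and> j * l + t \<in> S} (block l j x))"
proof -
  have "(\<Prod>j<k. cube_monom l {t. t < l \<and> j * l + t \<in> S} (block l j x)) =
      (\<Prod>j<k. \<Prod>t\<in>{t. t < l \<and> j * l + t \<in> S}. x (j * l + t))"
    by (intro prod.cong refl) (simp add: cube_monom_def block_in_cube, simp add: block_def)
  also have "\<dots> = (\<Prod>(j, t)\<in>(SIGMA j:{..<k}. {t. t < l \<and> j * l + t \<in> S}). x (j * l + t))"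
    by (subst prod.Sigma) auto
  also have "\<dots> = (\<Prod>i\<in>S. x i)"
    using prod.reindex_bij_betw[OF bij_betw_blocks[OF assms(1)], of x]
    by (simp add: case_prod_unfold)
  finally show ?thesis
    using assms(2) by (simp add: cube_monom_def)
qed

text \<open>A monomial factors over the blocks. Each factor expands into basis elements of level at
  most its own degree, and multiplying out yields products whose levels add up to at most the total
  degree.\<close>

lemma deg_le_prod_span:
  assumes "g \<in> deg_le (k * l) r"
  shows "g \<in> bf.span (prod_elem k ` {\<omega> \<in> idx k. prod_lev k \<omega> \<le> r})"
  using assms
proof (rule deg_le_induct)
  let ?H = "bf.span (prod_elem k ` {\<omega> \<in> idx k. prod_lev k \<omega> \<le> r})"
  show "bf.subspace {g. g \<in> ?H}"
    by simp
  fix S assume S: "S \<subseteq> {..<k * l}" "card S \<le> r"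
  define T where "T j = {t. t < l \<and> j * l + t \<in> S}" for j
  have "(\<Sum>j<k. card (T j)) = card (SIGMA j:{..<k}. T j)"
    by (subst card_SigmaI) (auto simp: T_def)
  also have "\<dots> = card S"
    unfolding T_def by (rule bij_betw_same_card[OF bij_betw_blocks[OF S(1)]])
  finally have card_T: "(\<Sum>j<k. card (T j)) \<le> r"
    using S(2) by simp
  have "\<forall>j. \<exists>c. cube_monom l (T j) = (\<Sum>e\<in>X \<times> UNIV. bit_scale (c e) (elem e)) \<and>
      (\<forall>e. c e \<noteq> 0 \<longrightarrow> lev e \<le> card (T j))"
    by (intro allI elem_expansion cube_monom_in_deg_le) (auto simp: T_def)
  from choice[OF this] obtain c where c': "\<forall>j. cube_monom l (T j) =
      (\<Sum>e\<in>X \<times> UNIV. bit_scale (c j e) (elem e)) \<and> (\<forall>e. c j e \<noteq> 0 \<longrightarrow> lev e \<le> card (T j))"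
    by (elim exE)
  then have c: "cube_monom l (T j) = (\<Sum>e\<in>X \<times> UNIV. bit_scale (c j e) (elem e))"
    and c_lev: "c j e \<noteq> 0 \<Longrightarrow> lev e \<le> card (T j)" for j e
    by (simp, metis)
  have "cube_monom (k * l) S = (\<Sum>\<omega>\<in>idx k. bit_scale (\<Prod>j<k. c j (\<omega> j)) (prod_elem k \<omega>))"
  proof
    fix x
    show "cube_monom (k * l) S x = (\<Sum>\<omega>\<in>idx k. bit_scale (\<Prod>j<k. c j (\<omega> j)) (prod_elem k \<omega>)) x"
    proof (cases "x \<in> cube (k * l)")
      case True
      have "cube_monom (k * l) S x = (\<Prod>j<k. cube_monom l (T j) (block l j x))"
        unfolding T_def by (rule cube_monom_blocks[OF S(1) True])
      also have "\<dots> = (\<Prod>j<k. \<Sum>e\<in>X \<times> UNIV. c j e * elem e (block l j x))"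
        unfolding c by (simp only: sum_fun_apply bit_scale_apply)
      also have "\<dots> = (\<Sum>\<omega>\<in>idx k. \<Prod>j<k. c j (\<omega> j) * elem (\<omega> j) (block l j x))"
        unfolding idx_def using finite_X by (intro prod_sum_PiE) auto
      also have "\<dots> = (\<Sum>\<omega>\<in>idx k. bit_scale (\<Prod>j<k. c j (\<omega> j)) (prod_elem k \<omega>)) x"
        using True by (simp add: sum_fun_apply prod_elem_def prod.distrib)
      finally show ?thesis .
    next
      case False
      then show ?thesis
        by (simp add: sum_fun_apply prod_elem_def cube_monom_def)
    qed
  qed
  also have "\<dots> \<in> ?H"
  proof (rule bf.span_sum)
    fix \<omega> assume \<omega>: "\<omega> \<in> idx k"
    show "bit_scale (\<Prod>j<k. c j (\<omega> j)) (prod_elem k \<omega>) \<in> ?H"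
    \<comment> \<open>A product with nonzero coefficient has every block factor within its level
      bound.\<close>
    proof (cases "\<forall>j<k. c j (\<omega> j) \<noteq> 0")
      case True
      have "prod_lev k \<omega> \<le> (\<Sum>j<k. card (T j))"
        unfolding prod_lev_def using True c_lev by (intro sum_mono) auto
      then show ?thesis
        using \<omega> card_T by (intro bf.span_scale bf.span_base imageI) auto
    next
      case False
      then have "(\<Prod>j<k. c j (\<omega> j)) = 0"
        by (auto intro!: prod_zero)
      then show ?thesis
        by (simp only: bit_scale_0 bf.span_zero)
    qed
  qed
  finally show "cube_monom (k * l) S \<in> ?H" .
qed

text \<open>The products span a space of dimension \<open>2 ^ (k * l)\<close>, which is also the
  number of indices, so none can be spared. Removing the index rather than the function also rules
  out that two indices give the same product.\<close>

lemma prod_elem_irredundant: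
  assumes "\<omega> \<in> idx k"
  shows "prod_elem k \<omega> \<notin> bf.span (prod_elem k ` (idx k - {\<omega>}))"
proof
  let ?n = "k * l" and ?R = "prod_elem k ` (idx k - {\<omega>})"
  assume red: "prod_elem k \<omega> \<in> bf.span ?R"
  have all: "prod_elem k ` idx k \<subseteq> bf.span ?R"
  proof
    fix g assume "g \<in> prod_elem k ` idx k"
    then show "g \<in> bf.span ?R"
      using red by (cases "g = prod_elem k \<omega>") (auto intro: bf.span_base)
  qed
  have "cube_monom ?n ` Pow {..<?n} \<subseteq> bf.span ?R"
  proof
    fix g assume "g \<in> cube_monom ?n ` Pow {..<?n}"
    then have "g \<in> deg_le ?n ?n"
      by (auto intro!: cube_monom_in_deg_le dest: card_mono[rotated])
    then have "g \<in> bf.span (prod_elem k ` {\<omega> \<in> idx k. prod_lev k \<omega> \<le> ?n})"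
      by (rule deg_le_prod_span)
    moreover have "prod_elem k ` {\<omega> \<in> idx k. prod_lev k \<omega> \<le> ?n} \<subseteq> bf.span ?R"
      using all by auto
    ultimately show "g \<in> bf.span ?R"
      by (rule subsetD[OF bf.span_minimal[OF _ bf.subspace_span], rotated])
  qed
  with independent_cube_monom have "card (cube_monom ?n ` Pow {..<?n}) \<le> card ?R"
    by (rule bf_card_le) (simp add: finite_idx)
  also have "card (cube_monom ?n ` Pow {..<?n}) = 2 ^ ?n"
    by (simp add: card_image[OF inj_on_cube_monom] card_Pow)
  also have "card ?R \<le> card (idx k - {\<omega>})"
    by (rule card_image_le) (simp add: finite_idx)
  also have "\<dots> < card (idx k)"
    using finite_idx assms by (rule card_Diff1_less)
  finally show False
    by (simp add: card_idx)
qed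

section \<open>Multiplication by the block function\<close>

lemma raise_in_idx: "\<omega> \<in> idx k \<Longrightarrow> j < k \<Longrightarrow> raise j \<omega> \<in> idx k"
  using idx_fst[of \<omega> k j] by (auto simp: raise_def idx_def PiE_def Pi_def extensional_def)

text \<open>Since \<open>f * f = f\<close> over F_2, a block that already carries \<open>f\<close>
  stays unchanged.\<close>

lemma mult_prod_elem:
  assumes "j < k"
  shows "(\<lambda>x. f (block l j x)) * prod_elem k \<omega> = prod_elem k (raise j \<omega>)"
proof
  fix x
  have f_elem: "f z * elem (\<omega> j) z = elem (raise j \<omega> j) z" for z
    by (cases "f z") (simp_all add: elem_def raise_def)
  have "(\<Prod>i<k. elem (raise j \<omega> i) (block l i x)) =
      elem (raise j \<omega> j) (block l j x) * (\<Prod>i\<in>{..<k}-{j}. elem (\<omega> i) (block l i x))"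
    using assms by (subst prod.remove[of _ j]) (auto intro!: prod.cong simp: raise_def)
  also have "\<dots> = f (block l j x) * (\<Prod>i<k. elem (\<omega> i) (block l i x))"
    using assms by (subst (2) prod.remove[of _ j]) (auto simp: f_elem[symmetric] mult.assoc)
  finally show "((\<lambda>x. f (block l j x)) * prod_elem k \<omega>) x = prod_elem k (raise j \<omega>) x"
    by (simp add: prod_elem_def mult.left_commute)
qed

section \<open>Bad elements and the first good block\<close>

definition bad :: "nat \<Rightarrow> ((nat \<Rightarrow> bit) \<Rightarrow> bit) set" where
  "bad d = {A \<in> X. b A \<le> a A + d}"

lemma level_raise:
  assumes "\<omega> \<in> idx k" "j < k" "\<not> snd (\<omega> j)" "fst (\<omega> j) \<notin> bad d"
  shows "prod_lev k \<omega> + d < prod_lev k (raise j \<omega>)"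
proof -
  have "prod_lev k \<omega> = lev (\<omega> j) + (\<Sum>i\<in>{..<k}-{j}. lev (\<omega> i))"
    unfolding prod_lev_def using assms(2) by (subst sum.remove[of _ j]) auto
  moreover have "prod_lev k (raise j \<omega>) = lev (raise j \<omega> j) + (\<Sum>i\<in>{..<k}-{j}. lev (\<omega> i))"
    unfolding prod_lev_def using assms(2)
    by (subst sum.remove[of _ j]) (auto intro!: sum.cong simp: raise_def)
  moreover have "lev (\<omega> j) + d < lev (raise j \<omega> j)"
    using assms idx_fst[OF assms(1,2)] by (simp add: lev_def raise_def bad_def)
  ultimately show ?thesis
    by simp
qed

text \<open>It depends on first components only, so raising never moves it; for indices in
  \<open>good_idx k d\<close> it is below \<open>k\<close>.\<close>

definition good_block :: "nat \<Rightarrow> (nat \<Rightarrow> ((nat \<Rightarrow> bit) \<Rightarrow> bit) \<times> bool) \<Rightarrow> nat" where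
  "good_block d \<omega> = (LEAST j. fst (\<omega> j) \<notin> bad d)"

definition good_idx :: "nat \<Rightarrow> nat \<Rightarrow> (nat \<Rightarrow> ((nat \<Rightarrow> bit) \<Rightarrow> bit) \<times> bool) set" where
  "good_idx k d = {\<omega> \<in> idx k. \<exists>j<k. fst (\<omega> j) \<notin> bad d}"

text \<open>The index set of the family \<open>W\<close>.\<close>

definition low_idx :: "nat \<Rightarrow> nat \<Rightarrow> (nat \<Rightarrow> ((nat \<Rightarrow> bit) \<Rightarrow> bit) \<times> bool) set" where
  "low_idx k d = {\<omega> \<in> good_idx k d. \<not> snd (\<omega> (good_block d \<omega>))}"

lemma good_block:
  assumes "\<omega> \<in> good_idx k d"
  shows "good_block d \<omega> < k" "fst (\<omega> (good_block d \<omega>)) \<notin> bad d"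
proof -
  obtain j where j: "j < k" "fst (\<omega> j) \<notin> bad d"
    using assms by (auto simp: good_idx_def)
  show "fst (\<omega> (good_block d \<omega>)) \<notin> bad d"
    unfolding good_block_def using j(2) by (rule LeastI)
  have "good_block d \<omega> \<le> j"
    unfolding good_block_def using j(2) by (rule Least_le)
  then show "good_block d \<omega> < k"
    using j(1) by simp
qed

lemma good_block_cong:
  assumes "\<And>j. fst (\<omega> j) = fst (\<omega>' j)"
  shows "good_block d \<omega> = good_block d \<omega>'"
  by (simp add: good_block_def assms)

lemma fst_raise [simp]: "fst (raise j \<omega> i) = fst (\<omega> i)"
  by (simp add: raise_def)

lemma finite_low_idx: "finite (low_idx k d)"
  using finite_idx[of k] by (rule rev_finite_subset) (auto simp: low_idx_def good_idx_def)

text \<open>Raising the first good block maps \<open>low_idx\<close> onto the rest of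
  \<open>good_idx\<close>, so \<open>low_idx\<close> is at least half of it. An index outside
  \<open>good_idx\<close> has a bad element, with either flag, in each of the \<open>k\<close>
  blocks.\<close>

lemma card_low_idx: "2 ^ (k * l) \<le> 2 * card (low_idx k d) + (2 * card (bad d)) ^ k"
proof -
  let ?r = "\<lambda>\<omega>. raise (good_block d \<omega>) \<omega>"
  have sub: "good_idx k d - low_idx k d \<subseteq> ?r ` low_idx k d"
  proof
    fix \<omega> assume \<omega>: "\<omega> \<in> good_idx k d - low_idx k d"
    define i where "i = good_block d \<omega>"
    define \<omega>' where "\<omega>' = fun_upd \<omega> i (fst (\<omega> i), False)"
    have i: "i < k" "fst (\<omega> i) \<notin> bad d"
      using good_block \<omega> by (auto simp: i_def)
    have fst_eq: "fst (\<omega>' j) = fst (\<omega> j)" for j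
      by (simp add: \<omega>'_def)
    then have gb: "good_block d \<omega>' = i"
      unfolding i_def by (rule good_block_cong)
    have idx: "\<omega> \<in> idx k"
      using \<omega> by (simp add: good_idx_def)
    have "\<omega>' \<in> idx k"
      using idx i(1) idx_fst[OF idx i(1)]
      by (auto simp: \<omega>'_def idx_def PiE_def Pi_def extensional_def)
    then have "\<omega>' \<in> good_idx k d"
      unfolding good_idx_def using i by (intro CollectI conjI exI[of _ i]) (simp_all add: fst_eq)
    moreover have "\<not> snd (\<omega>' (good_block d \<omega>'))"
      unfolding gb by (simp add: \<omega>'_def)
    ultimately have low: "\<omega>' \<in> low_idx k d"
      by (simp add: low_idx_def)
    have "snd (\<omega> i)"
      using \<omega> by (simp add: low_idx_def i_def)
    then have "?r \<omega>' = \<omega>"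
      unfolding gb by (cases "\<omega> i") (auto simp: raise_def \<omega>'_def)
    then show "\<omega> \<in> ?r ` low_idx k d"
      using imageI[OF low, of ?r] by simp
  qed
  have fin: "finite (good_idx k d)"
    using finite_idx[of k] by (rule rev_finite_subset) (auto simp: good_idx_def)
  have "low_idx k d \<subseteq> good_idx k d"
    by (auto simp: low_idx_def)
  then have "card (good_idx k d) = card (low_idx k d) + card (good_idx k d - low_idx k d)"
    using fin card_mono[of "good_idx k d" "low_idx k d"] finite_low_idx by (simp add: card_Diff_subset)
  also have "card (good_idx k d - low_idx k d) \<le> card (low_idx k d)"
    using sub finite_low_idx by (rule surj_card_le[rotated])
  finally have good: "card (good_idx k d) \<le> 2 * card (low_idx k d)"
    by simp
  have "idx k - good_idx k d \<subseteq> PiE {..<k} (\<lambda>_. bad d \<times> UNIV)"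
  proof
    fix \<omega> assume \<omega>: "\<omega> \<in> idx k - good_idx k d"
    then have "fst (\<omega> j) \<in> bad d" if "j < k" for j
      using that by (auto simp: good_idx_def)
    then show "\<omega> \<in> PiE {..<k} (\<lambda>_. bad d \<times> UNIV)"
      using \<omega> by (auto simp: idx_def PiE_def Pi_def mem_Times_iff)
  qed
  then have "card (idx k - good_idx k d) \<le> card (PiE {..<k} (\<lambda>_. bad d \<times> (UNIV :: bool set)))"
    using finite_X by (intro card_mono finite_PiE) (auto simp: bad_def)
  also have "\<dots> = (2 * card (bad d)) ^ k"
    by (subst card_PiE) (auto simp: card_cartesian_product mult.commute)
  finally have "card (idx k - good_idx k d) \<le> (2 * card (bad d)) ^ k" .
  moreover have "card (idx k) = card (idx k - good_idx k d) + card (good_idx k d)"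
  proof -
    have "good_idx k d \<subseteq> idx k"
      by (auto simp: good_idx_def)
    then show ?thesis
      using fin card_mono[OF finite_idx, of "good_idx k d" k] by (simp add: card_Diff_subset)
  qed
  ultimately show ?thesis
    using good by (simp add: card_idx)
qed

text \<open>Over F_2 a nonzero element of the span of \<open>W\<close> is a sum over some
  \<open>Y\<close>. Let \<open>\<theta>\<close> in \<open>Y\<close> have the highest level after
  raising its first good block, giving \<open>\<theta>'\<close>. The product of
  \<open>\<theta>'\<close> arises exactly once from the sum of the \<open>f\<close> factors, and the
  terms with \<open>q\<close> have too low a degree to involve it, so it cannot cancel.\<close>

lemma low_idx_not_vanishing:
  assumes q: "q \<in> deg_le (k * l) d" and Y: "Y \<subseteq> low_idx k d" "Y \<noteq> {}"
  shows "((\<lambda>x. \<Sum>j<k. f (block l j x)) + q) * (\<Sum>\<omega>\<in>Y. prod_elem k \<omega>) \<noteq> 0"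
proof
  assume zero: "((\<lambda>x. \<Sum>j<k. f (block l j x)) + q) * (\<Sum>\<omega>\<in>Y. prod_elem k \<omega>) = 0"
  have finY: "finite Y"
    using Y(1) finite_low_idx by (rule finite_subset)
  have Yidx: "\<omega> \<in> idx k" and Ygood: "\<omega> \<in> good_idx k d"
    and Ylow: "\<not> snd (\<omega> (good_block d \<omega>))" if "\<omega> \<in> Y" for \<omega>
    using that Y(1) by (auto simp: low_idx_def good_idx_def)
  let ?r = "\<lambda>\<omega>. raise (good_block d \<omega>) \<omega>"
  define h where "h \<omega> = prod_lev k (?r \<omega>)" for \<omega>
  have "Max (h ` Y) \<in> h ` Y"
    using finY Y(2) by (intro Max_in) auto
  then obtain \<theta> where \<theta>: "\<theta> \<in> Y" "h \<theta> = Max (h ` Y)"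
    by auto
  have h_le: "h \<omega> \<le> h \<theta>" if "\<omega> \<in> Y" for \<omega>
    using that finY \<theta>(2) by simp
  define i where "i = good_block d \<theta>"
  define \<theta>' where "\<theta>' = raise i \<theta>"
  have i: "i < k"
    using good_block[OF Ygood[OF \<theta>(1)]] by (simp add: i_def)
  have \<theta>': "\<theta>' \<in> idx k"
    unfolding \<theta>'_def using Yidx[OF \<theta>(1)] i by (rule raise_in_idx)
  let ?H = "bf.span (prod_elem k ` (idx k - {\<theta>'}))"
  \<comment> \<open>Equal first components give \<open>\<omega>\<close> and \<open>\<theta>\<close>
    the same first good block \<open>i\<close>. Its flag is unset in \<open>\<omega>\<close> but set
    in \<open>\<theta>'\<close>, so the raise took place at \<open>i\<close>.\<close>
  have raise_eq: "\<omega> = \<theta> \<and> j = i" if \<omega>: "\<omega> \<in> Y" and "j < k" and eq: "raise j \<omega> = \<theta>'" for \<omega> j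
  proof -
    have fst_eq: "fst (\<omega> t) = fst (\<theta> t)" for t
      using arg_cong[OF eq, of "\<lambda>\<eta>. fst (\<eta> t)"] by (simp add: \<theta>'_def)
    then have gb: "good_block d \<omega> = i"
      unfolding i_def by (rule good_block_cong)
    have "snd (raise j \<omega> i)"
      unfolding eq by (simp add: \<theta>'_def raise_def)
    then have ji: "j = i"
      using Ylow[OF \<omega>] by (auto simp: gb raise_def split: if_splits)
    have "\<omega> t = \<theta> t" for t
    proof (cases "t = i")
      case True
      then show ?thesis
        using fst_eq[of i] Ylow[OF \<omega>] Ylow[OF \<theta>(1)] by (auto simp: gb i_def[symmetric] intro: prod_eqI)
    next
      case False
      then show ?thesis
        using fun_cong[OF eq, of t] by (simp add: raise_def \<theta>'_def ji)
    qed
    then show ?thesis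
      using ji by auto
  qed
  \<comment> \<open>Raising the good block of \<open>\<omega>\<close> gains more than
    \<open>d\<close>, and the result is at most the level of \<open>\<theta>'\<close>; hence
    \<open>\<theta>'\<close> lies above everything in the expansion.\<close>
  have q_in_H: "q * prod_elem k \<omega> \<in> ?H" if \<omega>: "\<omega> \<in> Y" for \<omega>
  proof -
    let ?L = "{\<eta> \<in> idx k. prod_lev k \<eta> \<le> d + prod_lev k \<omega>}"
    have "q * prod_elem k \<omega> \<in> deg_le (k * l) (d + prod_lev k \<omega>)"
      using q prod_elem_in_deg_le[OF Yidx[OF \<omega>]] by (rule deg_le_mult)
    then have "q * prod_elem k \<omega> \<in> bf.span (prod_elem k ` ?L)"
      by (rule deg_le_prod_span)
    moreover have "d + prod_lev k \<omega> < prod_lev k \<theta>'"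
      using level_raise[OF Yidx[OF \<omega>] good_block(1)[OF Ygood[OF \<omega>]] Ylow[OF \<omega>] good_block(2)[OF Ygood[OF \<omega>]]]
        h_le[OF \<omega>] by (simp add: h_def \<theta>'_def i_def)
    then have "prod_elem k ` ?L \<subseteq> prod_elem k ` (idx k - {\<theta>'})"
      by (intro image_mono) auto
    ultimately show ?thesis
      by (rule subsetD[OF bf.span_mono, rotated])
  qed
  let ?P = "Y \<times> {..<k}"
  let ?F = "\<lambda>p. prod_elem k (raise (snd p) (fst p))"
  have "((\<lambda>x. \<Sum>j<k. f (block l j x)) + q) * (\<Sum>\<omega>\<in>Y. prod_elem k \<omega>)
      = (\<Sum>\<omega>\<in>Y. (\<Sum>j<k. (\<lambda>x. f (block l j x)) * prod_elem k \<omega>) + q * prod_elem k \<omega>)"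
    by (simp add: fun_eq_iff sum_fun_apply sum_distrib_left sum_distrib_right distrib_right)
  also have "\<dots> = (\<Sum>\<omega>\<in>Y. \<Sum>j<k. prod_elem k (raise j \<omega>)) + (\<Sum>\<omega>\<in>Y. q * prod_elem k \<omega>)"
    by (simp add: sum.distrib mult_prod_elem)
  also have "(\<Sum>\<omega>\<in>Y. \<Sum>j<k. prod_elem k (raise j \<omega>)) = (\<Sum>p\<in>?P. ?F p)"
    by (simp add: sum.cartesian_product case_prod_unfold)
  also have "\<dots> = ?F (\<theta>, i) + (\<Sum>p\<in>?P - {(\<theta>, i)}. ?F p)"
    using finY \<theta>(1) i by (intro sum.remove) auto
  also have "?F (\<theta>, i) = prod_elem k \<theta>'"
    by (simp add: \<theta>'_def)
  finally have "prod_elem k \<theta>' + ((\<Sum>p\<in>?P - {(\<theta>, i)}. ?F p) + (\<Sum>\<omega>\<in>Y. q * prod_elem k \<omega>)) = 0"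
    using zero by (simp only: add.assoc)
  then have "prod_elem k \<theta>' = - ((\<Sum>p\<in>?P - {(\<theta>, i)}. ?F p) + (\<Sum>\<omega>\<in>Y. q * prod_elem k \<omega>))"
    by (rule eq_neg_iff_add_eq_0[THEN iffD2])
  also have "\<dots> \<in> ?H"
  proof (intro bf.span_neg bf.span_add bf.span_sum)
    fix p assume p: "p \<in> ?P - {(\<theta>, i)}"
    then have "raise (snd p) (fst p) \<in> idx k"
      using Yidx by (intro raise_in_idx) auto
    moreover have "raise (snd p) (fst p) \<noteq> \<theta>'"
      using p raise_eq[of "fst p" "snd p"] by (cases p) auto
    ultimately show "?F p \<in> ?H"
      by (intro bf.span_base imageI) simp
  qed (rule q_in_H)
  finally show False
    using prod_elem_irredundant[OF \<theta>'] by simp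
qed

text \<open>Restricting the sums over subsets of \<open>low_idx\<close> to the solution set is
  injective: if two sums agree there, \<open>e\<close> times the sum over the symmetric difference
  vanishes, which forces the difference to be empty. Comparing the numbers of subsets replaces a
  dimension argument.\<close>

lemma card_low_idx_le:
  assumes q: "q \<in> deg_le (k * l) d"
  shows "card (low_idx k d) \<le> card {x \<in> cube (k * l). (\<Sum>j<k. f (block l j x)) + q x = 1}"
proof -
  let ?S = "{x \<in> cube (k * l). (\<Sum>j<k. f (block l j x)) + q x = 1}"
  define u where "u Y = (\<Sum>\<omega>\<in>Y. prod_elem k \<omega>)" for Y
  define Z where "Z Y = {x \<in> ?S. u Y x = 1}" for Y
  have fin: "finite ?S"
    using finite_cube by simp
  have "inj_on Z (Pow (low_idx k d))"
  proof (rule inj_onI)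
    fix Y Y' assume Y: "Y \<in> Pow (low_idx k d)" "Y' \<in> Pow (low_idx k d)" and eq: "Z Y = Z Y'"
    have finY: "finite Y" "finite Y'"
      using Y by (auto intro: finite_subset[OF _ finite_low_idx])
    let ?D = "(Y - Y') \<union> (Y' - Y)"
    have "u Y + u Y' = u ?D"
    proof -
      have "u Y = u (Y \<inter> Y') + u (Y - Y')"
        unfolding u_def using finY(1) by (rule sum.Int_Diff)
      moreover have "u Y' = u (Y' \<inter> Y) + u (Y' - Y)"
        unfolding u_def using finY(2) by (rule sum.Int_Diff)
      moreover have "u ?D = u (Y - Y') + u (Y' - Y)"
        unfolding u_def using finY by (intro sum.union_disjoint) auto
      ultimately show ?thesis
        by (simp add: fun_eq_iff Int_commute add.left_commute add.assoc)
    qed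
    then have D: "u ?D x = u Y x + u Y' x" for x
      by (simp flip: plus_fun_apply)
    have same: "u Y x = u Y' x" if "x \<in> ?S" for x
    proof -
      have "u Y x = 1 \<longleftrightarrow> u Y' x = 1"
        using eq that unfolding Z_def by blast
      then show ?thesis
        by (cases "u Y x"; cases "u Y' x") auto
    qed
    have D0: "u ?D x = 0" if "x \<in> ?S" for x
      unfolding D same[OF that] by simp
    have "((\<lambda>x. \<Sum>j<k. f (block l j x)) + q) * u ?D = 0"
    proof
      fix x
      have "u ?D x = 0" if "x \<notin> cube (k * l)"
        using that by (simp add: u_def sum_fun_apply prod_elem_def)
      moreover have "(\<Sum>j<k. f (block l j x)) + q x = 0 \<or> u ?D x = 0" if "x \<in> cube (k * l)"
        using that D0[of x] by (cases "(\<Sum>j<k. f (block l j x)) + q x") auto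
      ultimately show "(((\<lambda>x. \<Sum>j<k. f (block l j x)) + q) * u ?D) x = 0 x"
        by (cases "x \<in> cube (k * l)") auto
    qed
    then have "?D = {}"
      using low_idx_not_vanishing[OF q, of ?D] Y unfolding u_def by auto
    then show "Y = Y'"
      by auto
  qed
  moreover have "Z ` Pow (low_idx k d) \<subseteq> Pow ?S"
    by (auto simp: Z_def)
  ultimately have "card (Pow (low_idx k d)) \<le> card (Pow ?S)"
    using fin by (intro card_inj_on_le) auto
  then show ?thesis
    by (simp add: card_Pow finite_low_idx fin)
qed

end

section \<open>The correlation bound\<close>

text \<open>The factor \<open>2 * m + 3\<close> is chosen so that the induction closes: consecutive
  coefficients have ratio \<open>2 * (2 * m + 3) / (m + 2)\<close>, and the step reduces to
  \<open>(2 * m + 3) * (2 * m + 5) \<le> (2 * m + 4)\<^sup>2\<close>.\<close>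

lemma binomial_middle_square_le: "(2 * m + 1 choose m)\<^sup>2 * (2 * m + 3) \<le> 4 ^ (2 * m + 1)"
proof (induction m)
  case (Suc m)
  define c c' where "c = (2 * m + 1 choose m)" and "c' = (2 * Suc m + 1 choose Suc m)"
  have "2 * Suc m + 1 = Suc (2 * m + 2)" "Suc (2 * m + 2) = 2 * m + 3"
    by simp_all
  then have step1: "Suc m * c' = (2 * m + 3) * (2 * m + 2 choose m)"
    unfolding c'_def using Suc_times_binomial[of m "2 * m + 2"] by (simp only:)
  have "(2 * m + 2 - m) * (2 * m + 2 choose m) = (2 * m + 2) * (2 * m + 2 - 1 choose m)"
    by (rule binomial_absorb_comp)
  moreover have "2 * m + 2 - m = m + 2" "2 * m + 2 - 1 = 2 * m + 1"
    by simp_all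
  ultimately have step2: "(m + 2) * (2 * m + 2 choose m) = (2 * m + 2) * c"
    unfolding c_def by (simp only:)
  have "Suc m * ((m + 2) * c') = (m + 2) * (Suc m * c')"
    by (simp only: mult.left_commute)
  also have "\<dots> = (2 * m + 3) * ((m + 2) * (2 * m + 2 choose m))"
    unfolding step1 by (simp only: mult.left_commute)
  also have "\<dots> = Suc m * (2 * (2 * m + 3) * c)"
    unfolding step2 by (simp add: algebra_simps)
  finally have "Suc m * ((m + 2) * c') = Suc m * (2 * (2 * m + 3) * c)" .
  then have rec: "(m + 2) * c' = 2 * (2 * m + 3) * c"
    by (simp only: mult_cancel1) simp
  have "(m + 2)\<^sup>2 * (c'\<^sup>2 * (2 * m + 5)) = ((m + 2) * c')\<^sup>2 * (2 * m + 5)"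
    by (simp only: power_mult_distrib mult.assoc)
  also have "\<dots> = c\<^sup>2 * (2 * m + 3) * (4 * ((2 * m + 3) * (2 * m + 5)))"
    unfolding rec by (simp add: power_mult_distrib power2_eq_square algebra_simps)
  also have "\<dots> \<le> 4 ^ (2 * m + 1) * (4 * (4 * (m + 2)\<^sup>2))"
  proof (rule mult_mono)
    show "c\<^sup>2 * (2 * m + 3) \<le> 4 ^ (2 * m + 1)"
      using Suc.IH by (simp only: c_def)
    show "4 * ((2 * m + 3) * (2 * m + 5)) \<le> 4 * (4 * (m + 2)\<^sup>2)"
      by (simp add: power2_eq_square algebra_simps)
  qed simp_all
  also have "\<dots> = (m + 2)\<^sup>2 * 4 ^ (2 * Suc m + 1)"
    by simp
  finally have "c'\<^sup>2 * (2 * m + 5) \<le> 4 ^ (2 * Suc m + 1)"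
    by (simp only: mult_le_cancel1) simp
  moreover have "2 * Suc m + 3 = 2 * m + 5"
    by simp
  ultimately show ?case
    unfolding c'_def by (simp only:)
qed simp

lemma binomial_middle_le:
  assumes "l = 2 * m + 1"
  shows "real (l choose m) / 2 ^ l \<le> 1 / sqrt (real l)"
proof -
  have "(l choose m)\<^sup>2 * l \<le> (l choose m)\<^sup>2 * (2 * m + 3)"
    using assms by (intro mult_left_mono) simp_all
  also have "\<dots> \<le> 4 ^ l"
    using binomial_middle_square_le[of m] assms by simp
  also have "\<dots> = (2 ^ l)\<^sup>2"
    by (simp add: power_mult[symmetric] mult.commute[of l] power_mult)
  finally have "real ((l choose m)\<^sup>2 * l) \<le> real ((2 ^ l)\<^sup>2)"
    by (rule of_nat_mono)
  then have "(real (l choose m) * sqrt (real l))\<^sup>2 \<le> (2 ^ l)\<^sup>2"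
    by (simp add: power_mult_distrib)
  then have "real (l choose m) * sqrt (real l) \<le> 2 ^ l"
    by (rule power2_le_imp_le) simp
  moreover have "0 < sqrt (real l)"
    using assms by simp
  ultimately show ?thesis
    by (simp add: field_simps)
qed

text \<open>Positive powers of a bit equal the bit, so a monomial acts as the multilinear monomial
  on its variables, whose number is at most its degree.\<close>

lemma poly_eval_in_deg_le:
  fixes p :: "bit mpoly"
  assumes vars: "poly_vars p \<subseteq> {..<n}" and deg: "total_degree p \<le> d"
  shows "(\<lambda>x. of_bool (x \<in> cube n) * poly_eval p x) \<in> deg_le n d"
proof -
  have "(\<lambda>x. of_bool (x \<in> cube n) * poly_eval p x) =
      (\<Sum>m\<in>Poly_Mapping.keys p. bit_scale (Poly_Mapping.lookup p m) (cube_monom n (Poly_Mapping.keys m)))"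
  proof
    fix x :: "nat \<Rightarrow> bit"
    have "(\<Prod>i\<in>Poly_Mapping.keys m. x i ^ Poly_Mapping.lookup m i) = (\<Prod>i\<in>Poly_Mapping.keys m. x i)"
      for m :: "nat \<Rightarrow>\<^sub>0 nat"
    proof (intro prod.cong refl)
      fix i assume "i \<in> Poly_Mapping.keys m"
      then have "Poly_Mapping.lookup m i \<noteq> 0"
        by (simp add: in_keys_iff)
      then show "x i ^ Poly_Mapping.lookup m i = x i"
        by (cases "x i") auto
    qed
    then show "of_bool (x \<in> cube n) * poly_eval p x = (\<Sum>m\<in>Poly_Mapping.keys p.
        bit_scale (Poly_Mapping.lookup p m) (cube_monom n (Poly_Mapping.keys m))) x"
      by (cases "x \<in> cube n") (simp_all add: poly_eval_def sum_fun_apply cube_monom_def)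
  qed
  also have "\<dots> \<in> deg_le n d"
  proof (intro deg_le_sum bf.subspace_scale[OF subspace_deg_le] cube_monom_in_deg_le)
    fix m assume m: "m \<in> Poly_Mapping.keys p"
    then show "Poly_Mapping.keys m \<subseteq> {..<n}"
      using vars by (auto simp: poly_vars_def)
    have "card (Poly_Mapping.keys m) = (\<Sum>i\<in>Poly_Mapping.keys m. 1)"
      by simp
    also have "\<dots> \<le> monom_degree m"
      unfolding monom_degree_def by (intro sum_mono) (simp add: in_keys_iff Suc_le_eq)
    also have "\<dots> \<le> total_degree p"
      unfolding total_degree_def using m by (intro Max_ge) auto
    finally show "card (Poly_Mapping.keys m) \<le> d"
      using deg by simp
  qed
  finally show ?thesis .
qed

text \<open>Both classes have at least \<open>(2 ^ n - c) / 2\<close> points and together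
  \<open>2 ^ n\<close>, so their sizes differ by at most \<open>c\<close>.\<close>

lemma corr_le:
  fixes c :: nat
  assumes "2 ^ n \<le> 2 * card {x \<in> cube n. f x + g x = 0} + c"
    and "2 ^ n \<le> 2 * card {x \<in> cube n. f x + g x = 1} + c"
  shows "corr n f g \<le> real c / 2 ^ n"
proof -
  let ?Z = "\<lambda>b. {x \<in> cube n. f x + g x = b}"
  have ne: "cube n \<noteq> {}"
    using ind_in_cube by blast
  have part: "cube n = ?Z 0 \<union> ?Z 1"
    using bit_not_zero_iff by blast
  have fin: "finite (?Z b)" for b
    using finite_cube by simp
  have disj: "?Z 0 \<inter> ?Z 1 = {}"
    by auto
  have "2 ^ n = card (?Z 0 \<union> ?Z 1)"
    using part by (simp add: card_cube[symmetric])
  also have "\<dots> = card (?Z 0) + card (?Z 1)"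
    by (rule card_Un_disjoint[OF fin fin disj])
  finally have total: "2 ^ n = card (?Z 0) + card (?Z 1)" .
  have "(\<Sum>x\<in>cube n. bit_sign (f x + g x)) = (\<Sum>x\<in>?Z 0 \<union> ?Z 1. bit_sign (f x + g x))"
    using part by simp
  also have "\<dots> = (\<Sum>x\<in>?Z 0. bit_sign (f x + g x)) + (\<Sum>x\<in>?Z 1. bit_sign (f x + g x))"
    by (rule sum.union_disjoint[OF fin fin disj])
  also have "(\<Sum>x\<in>?Z 0. bit_sign (f x + g x)) = (\<Sum>x\<in>?Z 0. 1)"
    by (intro sum.cong) (auto simp: bit_sign_def)
  also have "(\<Sum>x\<in>?Z 1. bit_sign (f x + g x)) = (\<Sum>x\<in>?Z 1. - 1)"
    by (intro sum.cong) (auto simp: bit_sign_def)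
  finally have "(\<Sum>x\<in>cube n. bit_sign (f x + g x)) = real (card (?Z 0)) - real (card (?Z 1))"
    by simp
  moreover have "\<bar>real (card (?Z 0)) - real (card (?Z 1))\<bar> \<le> real c"
    using assms total by linarith
  ultimately show ?thesis
    unfolding corr_def integral_pmf_of_set[OF ne finite_cube] card_cube
    by (simp add: divide_right_mono)
qed

theorem theorem1p1:
  fixes k l d :: nat and p :: "bit mpoly"
  assumes "k \<ge> 1" and "l \<ge> 1" and "odd l"
    and "poly_vars p \<subseteq> {..<k * l}" and "total_degree p \<le> d"
  shows "corr (k * l) (xor_maj k l) (poly_eval p) \<le> (2 * real d / sqrt (real l)) ^ k"
proof -
  let ?n = "k * l"
  obtain m where l: "l = 2 * m + 1"
    using \<open>odd l\<close> by (elim oddE)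
  obtain X a b where basis: "block_basis l (maj l) X a b"
    and bad: "card {A \<in> X. b A \<le> a A + d} \<le> d * (l choose m)"
    using l by (rule maj_block_basis)
  interpret block_basis l "maj l" X a b
    by (rule basis)
  define q where "q = (\<lambda>x. of_bool (x \<in> cube ?n) * poly_eval p x)"
  have q: "q \<in> deg_le ?n d"
    unfolding q_def using assms(4,5) by (rule poly_eval_in_deg_le)
  \<comment> \<open>The empty monomial is the constant 1 on the cube. Adding it exchanges the
    solutions of \<open>e = 0\<close> and \<open>e = 1\<close>, so the same count bounds
    both.\<close>
  have q': "q + cube_monom ?n {} \<in> deg_le ?n d"
    using q by (intro deg_le_add cube_monom_in_deg_le) auto
  let ?c = "(2 * card (bad d)) ^ k"
  have "{x \<in> cube ?n. (\<Sum>j<k. maj l (block l j x)) + q x = 1} =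
      {x \<in> cube ?n. xor_maj k l x + poly_eval p x = 1}"
    by (auto simp: q_def xor_maj_def)
  then have one: "2 ^ ?n \<le> 2 * card {x \<in> cube ?n. xor_maj k l x + poly_eval p x = 1} + ?c"
    using card_low_idx_le[OF q] card_low_idx[of k d] by simp
  have "{x \<in> cube ?n. (\<Sum>j<k. maj l (block l j x)) + (q + cube_monom ?n {}) x = 1} =
      {x \<in> cube ?n. xor_maj k l x + poly_eval p x = 0}"
    by (auto simp: q_def xor_maj_def cube_monom_def add.assoc[symmetric])
  then have zero: "2 ^ ?n \<le> 2 * card {x \<in> cube ?n. xor_maj k l x + poly_eval p x = 0} + ?c"
    using card_low_idx_le[OF q'] card_low_idx[of k d] by simp
  have "corr ?n (xor_maj k l) (poly_eval p) \<le> real ?c / 2 ^ ?n"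
    using zero one by (rule corr_le)
  also have "\<dots> = (2 * real (card (bad d)) / 2 ^ l) ^ k"
    by (simp add: power_divide power_mult[symmetric] mult.commute)
  \<comment> \<open>Per block, the count of bad elements and the estimate of the middle binomial
    combine to the base of the power.\<close>
  also have "\<dots> \<le> (2 * real d / sqrt (real l)) ^ k"
  proof (rule power_mono)
    have "real (card (bad d)) \<le> real d * real (l choose m)"
      using bad unfolding bad_def of_nat_mult[symmetric] of_nat_le_iff .
    then have "2 * real (card (bad d)) / 2 ^ l \<le> 2 * real d * (real (l choose m) / 2 ^ l)"
      by (simp add: divide_right_mono)
    also have "\<dots> \<le> 2 * real d * (1 / sqrt (real l))"
      using binomial_middle_le[OF l] by (intro mult_left_mono) auto
    finally show "2 * real (card (bad d)) / 2 ^ l \<le> 2 * real d / sqrt (real l)"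
      by simp
  qed simp
  finally show ?thesis .
qed

end
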